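(* Let $d\ge5$. (i) Assume $p>\frac d{d-2}$ and $p>\gamma>1+\frac{(p-2)^+}{(d-2)p+4}$. There are constants $c_1,c_2>0$ such that for all sufficiently large $n$ $$e^{-c_1n^{\gamma/p}}\le\mathbb P_0\left(\sum_{x\in\mathbb Z^d}l_n^p(x)>n^\gamma\right)\le e^{-c_2n^{\gamma/p}} .$$ (ii) Assume $1<p\le\frac d{d-2}$ and $p>\gamma>1$, and set $\zeta=1-\frac2d\,\frac{p-\gamma}{p-1}$. For any $\epsilon>0$ there are constants $d_1,d_2>0$ such that for all sufficiently large $n$ $$e^{-d_1n^{\zeta}}\le\mathbb P_0\left(\sum_{x\in\mathbb Z^d}l_n^p(x)>n^\gamma\right)\le e^{-d_2n^{\zeta-\epsilon}} .$$
   Context: $(S_k)_{k\ge0}$ is the nearest-neighbour symmetric random walk on $\mathbb Z^d$ with $S_0=0$, with law $\mathbb P_0$. Local times: $l_n(x)=\sum_{k=0}^n\mathbf 1\{S_k=x\}$, and $l_n^p(x)=(l_n(x))^p$. $u^+=\max(u,0)$. *)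

theory Defs
  imports "HOL-Probability.Probability"
begin

text \<open>
  The lattice \<open>\<int>\<^sup>d\<close> is the type \<open>int ^ 'd\<close> with \<open>d = CARD('d)\<close>.
\<close>

definition unit_steps :: "(int ^ 'd) set" where
  "unit_steps = (\<Union>i. {axis i 1, - axis i 1})"

lemma finite_unit_steps: "finite (unit_steps :: (int ^ 'd) set)"
  by (simp add: unit_steps_def)

lemma unit_steps_nonempty: "(unit_steps :: (int ^ 'd) set) \<noteq> {}"
  by (simp add: unit_steps_def)

lemma card_unit_steps: "card (unit_steps :: (int ^ 'd) set) = 2 * CARD('d)"
proof -
  have *: "(unit_steps :: (int ^ 'd) set) = (\<lambda>(i, s). axis i s) ` (UNIV \<times> {1, -1})"
    by (force simp: unit_steps_def axis_def vec_eq_iff image_iff)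
  have "inj_on (\<lambda>(i, s). axis i s :: int ^ 'd) (UNIV \<times> {1, -1})"
    by (auto simp: inj_on_def axis_eq_axis)
  then show ?thesis
    unfolding * by (simp add: card_image card_cartesian_product)
qed

text \<open>
  The walk started at 0 is realised on the space of its increments: under
  \<open>srw_steps\<close> the coordinates \<open>\<omega> 0, \<omega> 1, \<dots>\<close> are independent and uniform on the
  \<open>2d\<close> unit steps, and the walk is the sequence of partial sums of \<open>\<omega>\<close>.
\<close>

definition srw_steps :: "(nat \<Rightarrow> int ^ 'd) measure" where
  "srw_steps = (\<Pi>\<^sub>M k\<in>UNIV. measure_pmf (pmf_of_set unit_steps))"

definition walk :: "(nat \<Rightarrow> int ^ 'd) \<Rightarrow> nat \<Rightarrow> int ^ 'd" where
  "walk \<omega> k = (\<Sum>j<k. \<omega> j)"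

definition local_time :: "(nat \<Rightarrow> int ^ 'd) \<Rightarrow> nat \<Rightarrow> int ^ 'd \<Rightarrow> nat" where
  "local_time S n x = (\<Sum>k=0..n. of_bool (S k = x))"

end

(*
  Upper bounds. Let G be a superharmonic majorant of the Green kernel. If a weight F on the lattice
  changes only at the current position of the walk, then (1 + GF(S_k) / L) exp(sum F(S_j) / (2 L) - ...)
  is a supermartingale as long as GF <= L, which bounds the exponential moments of the sum of
  F_k(S_k). For the weight F_k(x) = (l_k(x)^(p - 1) - s)^+ this sum is comparable to the sum of the
  l_n(x)^p, so it remains to bound the potential of l_n^(p - 1). Applied to the indicator of a cube, the
  same supermartingale shows that outside an event of probability exp(-c u) (up to polynomial factors)
  every cube of side r is occupied for a time at most u r^2; in dimension at least 5 this bounds the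
  potential of l_n^q by C u^q for every q > 2 / (d - 2). For (i) take q = p - 1 and u = n^(gamma / p);
  for (ii) let q approach 2 / (d - 2), with s = c n^(gamma - 1) and u = n^zeta.

  Lower bounds. For (i) the walk oscillates between two neighbours for a time of order n^(gamma / p). For
  (ii) it stays in a cube with n^((p - gamma) / (p - 1)) sites up to time n; the probability of this is
  bounded below by means of the Dirichlet eigenfunction, a product of cosines.
*)

theory Submission
  imports Defs "HOL-Real_Asymp.Real_Asymp"
begin

section \<open>Averages over step sequences\<close>

text \<open>Only the first n steps matter, so expectations are finite averages over step lists: a
  supermartingale is one inequality about extending a list by a step, and stopping is replaced by
  the indicator of a property \<open>good\<close> that passes to shorter paths. The obstacle to
  exponential moments is that the weight is built from the local times themselves. Its growth at the
  j-th visit is of lower order than the weight, so it is absorbed into a fraction of the weight plus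
  a constant per step. In (ii), p - 1 is at most 2 / (d - 2), where the sum over dyadic scales no
  longer converges. Cutting at s costs about s n, which dictates s of order n^(gamma - 1), and buys
  (l^(p - 1) - s)^+ <= B l^q with q > 2 / (d - 2). The two rates n^gamma / (B u^q) and u balance at
  u = n^zeta in the limit q -> 2 / (d - 2); this is where epsilon is lost. In the lower bounds,
  Jensen's inequality gives a power sum of at least m^p |K|^(1 - p) for m visits to a set K. For m =
  n this dictates the size of the cube, and confinement then costs a rate n / |K|^(2 / d) =
  n^zeta.\<close>

text \<open>
  A path is encoded by the list of its steps in reverse order: the latest step is the head.
\<close>

fun loc :: "(int ^ 'd) list \<Rightarrow> int ^ 'd \<Rightarrow> nat" where
  "loc [] x = of_bool (x = 0)"
| "loc (s # xs) x = loc xs x + of_bool (sum_list (s # xs) = x)"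

declare loc.simps(2) [simp del]

primrec steps_upto :: "nat \<Rightarrow> (nat \<Rightarrow> 'a) \<Rightarrow> 'a list" where
  "steps_upto 0 \<omega> = []"
| "steps_upto (Suc n) \<omega> = \<omega> n # steps_upto n \<omega>"

text \<open>The latest step is averaged out first, given the earlier ones. This is the conditional
  expectation that a martingale argument needs: \<open>avg_mono\<close> turns a one-step inequality
  into an induction step.\<close>

primrec avg :: "nat \<Rightarrow> ((int ^ 'd) list \<Rightarrow> real) \<Rightarrow> real" where
  "avg 0 F = F []"
| "avg (Suc n) F = avg n (\<lambda>xs. (\<Sum>s\<in>unit_steps. F (s # xs)) / (2 * CARD('d)))"

lemma length_steps_upto [simp]: "length (steps_upto n \<omega>) = n"
  by (induction n) auto

lemma steps_upto_eq_iff: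
  "steps_upto n \<omega> = xs \<longleftrightarrow> length xs = n \<and> (\<forall>k<n. \<omega> k = rev xs ! k)"
proof (induction n arbitrary: xs)
  case (Suc n)
  show ?case
  proof (cases xs)
    case (Cons x ys)
    have "(\<forall>k<Suc n. \<omega> k = rev xs ! k) \<longleftrightarrow> \<omega> n = x \<and> (\<forall>k<n. \<omega> k = rev ys ! k)"
      if "length ys = n"
      using that by (auto simp: Cons nth_append less_Suc_eq)
    then show ?thesis using Suc by (auto simp: Cons)
  qed auto
qed auto

lemma sum_list_steps_upto: "sum_list (steps_upto n \<omega>) = walk \<omega> n"
  by (induction n) (auto simp: walk_def add.commute)

lemma loc_steps_upto: "loc (steps_upto n \<omega>) x = local_time (walk \<omega>) n x"
proof (induction n)
  case 0
  then show ?case by (auto simp: local_time_def walk_def)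
next
  case (Suc n)
  have "sum_list (steps_upto (Suc n) \<omega>) = walk \<omega> (Suc n)"
    by (rule sum_list_steps_upto)
  then show ?case
    using Suc by (simp add: loc.simps local_time_def)
qed

definition step_lists :: "nat \<Rightarrow> (int ^ 'd) list set" where
  "step_lists n = {xs. set xs \<subseteq> unit_steps \<and> length xs = n}"

lemma finite_step_lists: "finite (step_lists n)"
  unfolding step_lists_def by (rule finite_lists_length_eq[OF finite_unit_steps])

lemma step_lists_Suc:
  "step_lists (Suc n) = (\<lambda>(s, xs). s # xs) ` (unit_steps \<times> step_lists n)"
  by (auto simp: step_lists_def length_Suc_conv image_iff)

lemma avg_eq_sum:
  "avg n F = (\<Sum>xs\<in>step_lists n. F xs) / (2 * real CARD('d)) ^ n"
  for F :: "(int ^ 'd) list \<Rightarrow> real"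
proof (induction n arbitrary: F)
  case 0
  have "step_lists 0 = {[] :: (int ^ 'd) list}"
    by (auto simp: step_lists_def)
  then show ?case by simp
next
  case (Suc n)
  have "(\<Sum>xs\<in>step_lists (Suc n). F xs)
      = (\<Sum>(s, xs)\<in>unit_steps \<times> step_lists n. F (s # xs))"
    unfolding step_lists_Suc
    by (subst sum.reindex) (auto simp: inj_on_def case_prod_unfold o_def)
  also have "\<dots> = (\<Sum>xs\<in>step_lists n. \<Sum>s\<in>unit_steps. F (s # xs))"
    by (subst sum.swap, subst sum.cartesian_product) simp
  finally show ?case
    by (simp add: Suc sum_divide_distrib)
qed

lemma avg_mono:
  assumes "\<And>xs. xs \<in> step_lists n \<Longrightarrow> F xs \<le> F' xs"
  shows "avg n F \<le> avg n F'"
  unfolding avg_eq_sum by (intro divide_right_mono sum_mono assms) auto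

lemma avg_cmult: "avg n (\<lambda>xs. c * F xs) = c * avg n F"
  unfolding avg_eq_sum by (simp add: sum_distrib_left)

lemma avg_add: "avg n (\<lambda>xs. F xs + F' xs) = avg n F + avg n F'"
  unfolding avg_eq_sum by (simp add: sum.distrib add_divide_distrib)

lemma avg_sum: "avg n (\<lambda>xs. \<Sum>i\<in>I. F i xs) = (\<Sum>i\<in>I. avg n (F i))"
  unfolding avg_eq_sum by (subst sum.swap) (simp add: sum_divide_distrib)

text \<open>The step space also contains sequences with steps outside \<open>unit_steps\<close>.
  Countably many cylinders give measurability; the probability is computed on the finitely many
  lists of unit steps, whose total mass 1 makes the rest null.\<close>

lemma prob_steps_eq_avg:
  fixes R :: "(int ^ 'd) list \<Rightarrow> bool"
  shows "\<P>(\<omega> in srw_steps. R (steps_upto n \<omega>)) = avg n (\<lambda>xs. of_bool (R xs))"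
    and "{\<omega> \<in> space srw_steps. R (steps_upto n \<omega>)} \<in> sets srw_steps"
proof -
  let ?U = "unit_steps :: (int ^ 'd) set"
  let ?M = "srw_steps :: (nat \<Rightarrow> int ^ 'd) measure"
  interpret product_prob_space "\<lambda>_::nat. measure_pmf (pmf_of_set ?U)" UNIV
    by unfold_locales
  have srw: "srw_steps = PiM UNIV (\<lambda>_::nat. measure_pmf (pmf_of_set ?U))"
    by (simp add: srw_steps_def)
  have sp: "space srw_steps = (UNIV :: (nat \<Rightarrow> int ^ 'd) set)"
    by (simp add: srw space_PiM)
  \<comment> \<open>\<open>rev\<close> restores the order of time, since the head of a list is the
    latest step.\<close>
  define Cy where "Cy xs = {\<omega> \<in> space srw_steps. \<forall>k\<in>{..<length xs}. \<omega> k \<in> {rev xs ! k}}"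
    for xs :: "(int ^ 'd) list"
  have Cy_sets: "Cy xs \<in> sets srw_steps" for xs
    unfolding Cy_def srw by measurable
  have Cy_eq: "Cy xs = {\<omega>. steps_upto (length xs) \<omega> = xs}" for xs
    by (auto simp: Cy_def sp steps_upto_eq_iff)
  have split: "{\<omega> \<in> space srw_steps. R' (steps_upto n \<omega>)} = (\<Union>xs\<in>{xs. length xs = n \<and> R' xs}. Cy xs)"
    for R' :: "(int ^ 'd) list \<Rightarrow> bool"
    by (auto simp: Cy_eq sp)
  have meas: "{\<omega> \<in> space srw_steps. R' (steps_upto n \<omega>)} \<in> sets srw_steps"
    for R' :: "(int ^ 'd) list \<Rightarrow> bool"
    unfolding split by (intro sets.countable_UN') (auto simp: Cy_sets)
  show "{\<omega> \<in> space srw_steps. R (steps_upto n \<omega>)} \<in> sets srw_steps"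
    by (rule meas)
  have pU: "measure (measure_pmf (pmf_of_set ?U)) {x} = of_bool (x \<in> ?U) / (2 * CARD('d))" for x
    by (simp add: measure_pmf_of_set finite_unit_steps unit_steps_nonempty card_unit_steps
        Int_insert_right indicator_def flip: of_bool_def)
  have prob_Cy: "measure srw_steps (Cy xs) = (1 / (2 * CARD('d))) ^ length xs"
    if "set xs \<subseteq> ?U" for xs
  proof -
    have "emeasure ?M (Cy xs) = (\<Prod>k<length xs. emeasure (measure_pmf (pmf_of_set ?U)) {rev xs ! k})"
      unfolding Cy_def srw by (rule emeasure_PiM_Collect) auto
    also have "\<dots> = ennreal (\<Prod>k<length xs. measure (measure_pmf (pmf_of_set ?U)) {rev xs ! k})"
      unfolding measure_pmf.emeasure_eq_measure by (rule prod_ennreal) (rule measure_nonneg)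
    finally have "measure ?M (Cy xs) = (\<Prod>k<length xs. measure (measure_pmf (pmf_of_set ?U)) {rev xs ! k})"
      by (intro measure_eq_emeasure_eq_ennreal prod_nonneg) auto
    also have "\<dots> = (\<Prod>k<length xs. 1 / (2 * CARD('d)))"
    proof (intro prod.cong refl)
      fix k assume "k \<in> {..<length xs}"
      then have "rev xs ! k \<in> set (rev xs)" by (intro nth_mem) auto
      then have "rev xs ! k \<in> ?U" using that by auto
      then show "measure (measure_pmf (pmf_of_set ?U)) {rev xs ! k} = 1 / (2 * CARD('d))"
        by (simp add: pU)
    qed
    finally show ?thesis by simp
  qed
  interpret S: prob_space ?M unfolding srw by unfold_locales
  have good: "measure ?M {\<omega> \<in> space ?M. R' (steps_upto n \<omega>) \<and> set (steps_upto n \<omega>) \<subseteq> ?U}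
     = avg n (\<lambda>xs. of_bool (R' xs))" for R'
  proof -
    have "{\<omega> \<in> space ?M. R' (steps_upto n \<omega>) \<and> set (steps_upto n \<omega>) \<subseteq> ?U}
        = (\<Union>xs\<in>{xs\<in>step_lists n. R' xs}. Cy xs)"
      by (auto simp: Cy_eq sp step_lists_def)
    also have "measure ?M \<dots> = (\<Sum>xs\<in>{xs\<in>step_lists n. R' xs}. measure ?M (Cy xs))"
    proof (rule S.finite_measure_finite_Union)
      show "finite {xs\<in>step_lists n. R' xs}" by (simp add: finite_step_lists)
      show "Cy ` {xs\<in>step_lists n. R' xs} \<subseteq> sets ?M" using Cy_sets by blast
      show "disjoint_family_on Cy {xs\<in>step_lists n. R' xs}"
        by (auto simp: disjoint_family_on_def Cy_eq step_lists_def)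
    qed
    also have "\<dots> = (\<Sum>xs\<in>{xs\<in>step_lists n. R' xs}. (1 / (2 * CARD('d))) ^ n)"
      by (intro sum.cong refl) (auto simp: step_lists_def prob_Cy)
    also have "\<dots> = avg n (\<lambda>xs. of_bool (R' xs))"
      by (simp add: avg_eq_sum of_bool_def sum.If_cases finite_step_lists Int_def field_simps)
    finally show ?thesis .
  qed
  have cardn: "(\<Sum>xs\<in>(step_lists n :: (int ^ 'd) list set). 1) = (2 * real CARD('d)) ^ n"
    by (simp add: step_lists_def card_lists_length_eq finite_unit_steps card_unit_steps)
  have one: "measure ?M {\<omega> \<in> space ?M. set (steps_upto n \<omega>) \<subseteq> ?U} = 1"
    using good[of "\<lambda>_. True"] cardn by (simp add: avg_eq_sum)
  have AE: "AE \<omega> in ?M. set (steps_upto n \<omega>) \<subseteq> ?U"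
    by (subst S.prob_Collect_eq_1[symmetric]) (auto intro: meas[of "\<lambda>xs. set xs \<subseteq> ?U"] one)
  have "measure ?M {\<omega> \<in> space ?M. R (steps_upto n \<omega>)}
      = measure ?M {\<omega> \<in> space ?M. R (steps_upto n \<omega>) \<and> set (steps_upto n \<omega>) \<subseteq> ?U}"
    using AE by (intro S.finite_measure_eq_AE) (auto intro: meas meas[of "\<lambda>xs. R xs \<and> set xs \<subseteq> ?U"])
  then show "\<P>(\<omega> in srw_steps. R (steps_upto n \<omega>)) = avg n (\<lambda>xs. of_bool (R xs))"
    by (simp add: good)
qed

lemma sum_unit_steps:
  "(\<Sum>s\<in>unit_steps. f s) = (\<Sum>i\<in>UNIV. f (axis i 1) + f (- axis i 1))"
  for f :: "int ^ 'd \<Rightarrow> real"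
proof -
  have "(\<Sum>s\<in>unit_steps. f s) = (\<Sum>i\<in>UNIV. sum f {axis i 1, - axis i 1})"
    unfolding unit_steps_def
  proof (intro sum.UNION_disjoint ballI impI)
    fix i j :: 'd assume "i \<noteq> j"
    then show "{axis i 1, - axis i 1} \<inter> {axis j 1, - axis j (1::int)} = {}"
      by (force simp: vec_eq_iff axis_def)
  qed auto
  also have "\<dots> = (\<Sum>i\<in>UNIV. f (axis i 1) + f (- axis i 1))"
  proof (intro sum.cong refl)
    fix i :: 'd
    have "axis i 1 \<noteq> - axis i (1::int)"
      by (auto simp: vec_eq_iff axis_def)
    then show "sum f {axis i 1, - axis i 1} = f (axis i 1) + f (- axis i 1)"
      by simp
  qed
  finally show ?thesis .
qed

section \<open>Confinement and lower bounds\<close>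

text \<open>The graph of \<open>t powr p\<close> lies above its tangent at \<open>b\<close>; this is
  Young's inequality for the exponents \<open>p\<close> and \<open>p / (p - 1)\<close>.\<close>

lemma powr_tangent:
  fixes a b p :: real
  assumes "p > 1" "a \<ge> 0" "b > 0"
  shows "p * b powr (p - 1) * a \<le> a powr p + (p - 1) * b powr p"
proof -
  have "a * b powr (p - 1) \<le> a powr p / p + (b powr (p - 1)) powr (p / (p - 1)) / (p / (p - 1))"
    using assms by (intro Youngs_inequality) (auto simp: field_simps)
  also have "(b powr (p - 1)) powr (p / (p - 1)) = b powr p"
    using assms by (simp add: powr_powr)
  finally have "p * (a * b powr (p - 1)) \<le> p * (a powr p / p + b powr p / (p / (p - 1)))"
    using assms by (intro mult_left_mono) auto
  also have "\<dots> = a powr p + (p - 1) * b powr p"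
    using assms by (simp add: distrib_left)
  finally show ?thesis by (simp add: mult_ac)
qed

text \<open>Jensen's inequality: the tangent at the mean \<open>b\<close>, summed over
  \<open>K\<close>.\<close>

lemma sum_powr_ge:
  fixes a :: "'a \<Rightarrow> real"
  assumes "finite K" "K \<noteq> {}" "p > 1" "\<And>x. x \<in> K \<Longrightarrow> a x \<ge> 0" "sum a K > 0"
  shows "(\<Sum>x\<in>K. a x powr p) \<ge> sum a K powr p * real (card K) powr (1 - p)"
proof -
  define b where "b = sum a K / card K"
  have K: "card K > 0" using assms by (simp add: card_gt_0_iff)
  have b: "b > 0" unfolding b_def using assms K by auto
  have "(\<Sum>x\<in>K. p * b powr (p - 1) * a x) \<le> (\<Sum>x\<in>K. a x powr p + (p - 1) * b powr p)"
    using assms b by (intro sum_mono powr_tangent) auto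
  then have "p * b powr (p - 1) * sum a K \<le> (\<Sum>x\<in>K. a x powr p) + card K * ((p - 1) * b powr p)"
    by (simp add: sum_distrib_left sum.distrib)
  moreover have "sum a K = card K * b"
    using K by (simp add: b_def)
  moreover have "b powr (p - 1) * b = b powr p"
    using b by (simp add: powr_diff)
  ultimately have "p * (card K * b powr p) \<le> (\<Sum>x\<in>K. a x powr p) + (p - 1) * (card K * b powr p)"
    by (metis mult.assoc mult.commute)
  then have "card K * b powr p \<le> (\<Sum>x\<in>K. a x powr p)"
    by (simp add: left_diff_distrib)
  moreover have "card K * b powr p = sum a K powr p * real (card K) powr (1 - p)"
    using K assms by (simp add: b_def powr_divide powr_diff)
  ultimately show ?thesis by simp
qed

section \<open>Power sums of local times\<close>

lemma finite_loc: "finite {x. loc xs x > 0}"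
proof (induction xs)
  case (Cons s xs)
  have "{x. loc (s # xs) x > 0} \<subseteq> insert (sum_list (s # xs)) {x. loc xs x > 0}"
    by (auto simp: loc.simps)
  then show ?case using Cons by (meson finite_insert finite_subset)
qed auto

lemma infsum_loc_powr:
  assumes "finite Y" "{x. loc xs x > 0} \<subseteq> Y"
  shows "(\<Sum>\<^sub>\<infinity>x. real (loc xs x) powr p) = (\<Sum>x\<in>Y. real (loc xs x) powr p)"
proof -
  have "(\<Sum>\<^sub>\<infinity>x. real (loc xs x) powr p) = (\<Sum>\<^sub>\<infinity>x\<in>Y. real (loc xs x) powr p)"
    using assms by (intro infsum_cong_neutral) auto
  then show ?thesis using assms by simp
qed

lemma loc_steps_upto_mono:
  assumes "m \<le> n"
  shows "loc (steps_upto m \<omega>) x \<le> loc (steps_upto n \<omega>) x"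
  using assms by (induction n rule: dec_induct) (auto simp: loc.simps)

lemma infsum_loc_steps_upto_mono:
  assumes "m \<le> n" "p > 0"
  shows "(\<Sum>\<^sub>\<infinity>x. real (loc (steps_upto m \<omega>) x) powr p) \<le> (\<Sum>\<^sub>\<infinity>x. real (loc (steps_upto n \<omega>) x) powr p)"
proof -
  define Y where "Y = {x. loc (steps_upto n \<omega>) x > 0}"
  have "{x. loc (steps_upto m \<omega>) x > 0} \<subseteq> Y"
    using loc_steps_upto_mono[OF assms(1), of \<omega>] by (auto simp: Y_def intro: less_le_trans)
  moreover have "finite Y" by (simp add: Y_def finite_loc)
  ultimately show ?thesis
    using assms loc_steps_upto_mono[OF assms(1), of \<omega>]
    by (subst (1 2) infsum_loc_powr[of Y]) (auto intro!: sum_mono powr_mono2 simp: Y_def)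
qed

section \<open>Confinement to a finite set\<close>

fun stays :: "(int ^ 'd) set \<Rightarrow> (int ^ 'd) list \<Rightarrow> bool" where
  "stays K [] \<longleftrightarrow> 0 \<in> K"
| "stays K (s # xs) \<longleftrightarrow> stays K xs \<and> sum_list (s # xs) \<in> K"

declare stays.simps(2) [simp del]

lemma stays_last: "stays K xs \<Longrightarrow> sum_list xs \<in> K"
  by (cases xs) (auto simp: stays.simps)

lemma sum_loc_stays: "finite K \<Longrightarrow> stays K xs \<Longrightarrow> (\<Sum>x\<in>K. loc xs x) = Suc (length xs)"
  by (induction xs) (simp_all add: loc.simps stays.simps sum.distrib of_bool_def)

text \<open>On paths kept in \<open>K\<close>, \<open>f\<close> at the current position divided by
  \<open>lam ^ m\<close> is a submartingale started at 1: as \<open>f\<close> vanishes off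
  \<open>K\<close>, a step that leaves \<open>K\<close> contributes nothing.\<close>

lemma avg_stays_ge:
  fixes f :: "int ^ 'd \<Rightarrow> real"
  assumes step: "\<And>x. x \<in> K \<Longrightarrow> lam * f x \<le> (\<Sum>s\<in>unit_steps. f (x + s)) / (2 * CARD('d))"
    and out: "\<And>x. x \<notin> K \<Longrightarrow> f x = 0" and le1: "\<And>x. f x \<le> 1"
    and f0: "f 0 = 1" and lam: "lam \<ge> 0"
  shows "lam ^ m \<le> avg m (\<lambda>xs. of_bool (stays K xs))"
proof -
  have "lam ^ m \<le> avg m (\<lambda>xs. of_bool (stays K xs) * f (sum_list xs))"
  proof (induction m)
    case 0
    have "0 \<in> K" using f0 out by force
    then show ?case by (simp add: f0)
  next
    case (Suc m)
    have "lam ^ Suc m \<le> lam * avg m (\<lambda>xs. of_bool (stays K xs) * f (sum_list xs))"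
      using Suc lam by (simp add: mult_left_mono)
    also have "\<dots> = avg m (\<lambda>xs. lam * (of_bool (stays K xs) * f (sum_list xs)))"
      by (simp add: avg_cmult)
    also have "\<dots> \<le> avg m (\<lambda>xs. (\<Sum>s\<in>unit_steps. of_bool (stays K (s # xs)) * f (sum_list (s # xs)))
        / (2 * CARD('d)))"
    proof (rule avg_mono)
      fix xs :: "(int ^ 'd) list"
      have "(\<Sum>s\<in>unit_steps. of_bool (stays K (s # xs)) * f (sum_list (s # xs)))
          = (\<Sum>s\<in>unit_steps. of_bool (stays K xs) * f (sum_list xs + s))"
        using out by (intro sum.cong) (auto simp: stays.simps add.commute)
      also have "\<dots> / (2 * CARD('d))
          = of_bool (stays K xs) * ((\<Sum>s\<in>unit_steps. f (sum_list xs + s)) / (2 * CARD('d)))"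
        by (simp add: sum_distrib_left)
      finally show "lam * (of_bool (stays K xs) * f (sum_list xs)) \<le>
         (\<Sum>s\<in>unit_steps. of_bool (stays K (s # xs)) * f (sum_list (s # xs))) / (2 * CARD('d))"
        using step[OF stays_last, of xs] by (cases "stays K xs") auto
    qed
    finally show ?case by simp
  qed
  also have "\<dots> \<le> avg m (\<lambda>xs. of_bool (stays K xs))"
    using le1 by (intro avg_mono) auto
  finally show ?thesis .
qed

text \<open>Up to time \<open>m\<close> the confined walk makes \<open>m + 1\<close> visits to
  \<open>card K\<close> sites, and by Jensen their power sum is least when they are spread evenly.
  Later visits only increase it.\<close>

lemma prob_ge_of_confinement:
  fixes f :: "int ^ 'd \<Rightarrow> real"
  assumes "\<And>x. x \<in> K \<Longrightarrow> lam * f x \<le> (\<Sum>s\<in>unit_steps. f (x + s)) / (2 * CARD('d))"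
    and "\<And>x. x \<notin> K \<Longrightarrow> f x = 0" and "\<And>x. f x \<le> 1"
    and "f 0 = 1" and "lam \<ge> 0"
    and K: "finite K" and p: "p > 1" and m: "m \<le> n"
    and A: "A < (real m + 1) powr p * real (card K) powr (1 - p)"
  shows "lam ^ m \<le> \<P>(\<omega> in srw_steps. (\<Sum>\<^sub>\<infinity>x::int^'d. real (local_time (walk \<omega>) n x) powr p) > A)"
proof -
  have "lam ^ m \<le> avg m (\<lambda>xs. of_bool (stays K xs))"
    by (rule avg_stays_ge[of K lam f]) (use assms in auto)
  also have "\<dots> = \<P>(\<omega> in srw_steps. stays K (steps_upto m \<omega>))"
    by (rule prob_steps_eq_avg(1)[symmetric])
  also have "\<dots> \<le> \<P>(\<omega> in srw_steps. (\<Sum>\<^sub>\<infinity>x::int^'d. real (loc (steps_upto n \<omega>) x) powr p) > A)"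
  proof (rule finite_measure.finite_measure_mono)
    show "finite_measure (srw_steps :: (nat \<Rightarrow> int ^ 'd) measure)"
      unfolding srw_steps_def
      by (intro prob_space.finite_measure prob_space_PiM measure_pmf.prob_space_axioms)
    show "{\<omega> \<in> space srw_steps. (\<Sum>\<^sub>\<infinity>x::int^'d. real (loc (steps_upto n \<omega>) x) powr p) > A} \<in> sets srw_steps"
      by (rule prob_steps_eq_avg(2))
    have "(\<Sum>\<^sub>\<infinity>x::int^'d. real (loc (steps_upto n \<omega>) x) powr p) > A"
      if st: "stays K (steps_upto m \<omega>)" for \<omega>
    proof -
      let ?l = "loc (steps_upto m \<omega>)"
      have "K \<noteq> {}" using stays_last[OF st] by auto
      have s: "(\<Sum>x\<in>K. real (?l x)) = real m + 1"
        using arg_cong[OF sum_loc_stays[OF K st], of real] by simp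
      have "A < (\<Sum>x\<in>K. real (?l x)) powr p * real (card K) powr (1 - p)"
        using A by (simp add: s)
      also have "\<dots> \<le> (\<Sum>x\<in>K. real (?l x) powr p)"
        using K \<open>K \<noteq> {}\<close> p by (intro sum_powr_ge) (auto simp: s)
      also have "\<dots> \<le> (\<Sum>x\<in>K \<union> {x. ?l x > 0}. real (?l x) powr p)"
        using K by (intro sum_mono2) (auto simp: finite_loc)
      also have "\<dots> = (\<Sum>\<^sub>\<infinity>x. real (?l x) powr p)"
        using K by (intro infsum_loc_powr[symmetric]) (auto simp: finite_loc)
      also have "\<dots> \<le> (\<Sum>\<^sub>\<infinity>x. real (loc (steps_upto n \<omega>) x) powr p)"
        using p m by (intro infsum_loc_steps_upto_mono) auto
      finally show ?thesis .
    qed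
    then show "{\<omega> \<in> space srw_steps. stays K (steps_upto m \<omega>)}
      \<subseteq> {\<omega> \<in> space srw_steps. (\<Sum>\<^sub>\<infinity>x::int^'d. real (loc (steps_upto n \<omega>) x) powr p) > A}"
      by auto
  qed
  finally show ?thesis by (simp add: loc_steps_upto)
qed

section \<open>The two confining sets: a pair of neighbours and a cube\<close>

lemma prob_ge_two_points:
  assumes p: "p > 1" and m: "m \<le> n" and A: "A < (real m + 1) powr p * 2 powr (1 - p)"
  shows "(1 / (2 * CARD('d))) ^ m
     \<le> \<P>(\<omega> in srw_steps. (\<Sum>\<^sub>\<infinity>x::int^'d. real (local_time (walk \<omega>) n x) powr p) > A)"
proof -
  \<comment> \<open>Only fixes an arbitrary coordinate direction.\<close>
  obtain i :: 'd where True by simp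
  define e :: "int ^ 'd" where "e = axis i 1"
  have e0: "e \<noteq> 0" by (simp add: e_def axis_eq_0_iff)
  have e: "e \<in> unit_steps" "- e \<in> unit_steps"
    by (auto simp: e_def unit_steps_def)
  \<comment> \<open>From either site one of the \<open>2d\<close> steps leads to the other, so the
    indicator satisfies the eigenvalue inequality with \<open>1 / (2d)\<close>.\<close>
  define f :: "int ^ 'd \<Rightarrow> real" where "f = indicator {0, e}"
  show ?thesis
  proof (rule prob_ge_of_confinement[of "{0, e}" _ f])
    fix x assume "x \<in> {0, e}"
    then have "\<exists>s\<in>unit_steps. x + s \<in> {0, e}"
    proof (cases "x = 0")
      case True
      then show ?thesis using e by (intro bexI[of _ e]) auto
    next
      case False
      then show ?thesis using e \<open>x \<in> {0, e}\<close> by (intro bexI[of _ "- e"]) auto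
    qed
    then obtain s where s: "s \<in> unit_steps" "x + s \<in> {0, e}" by blast
    have "1 = f (x + s)" using s by (simp add: f_def)
    also have "\<dots> \<le> (\<Sum>s\<in>unit_steps. f (x + s))"
      using s by (intro member_le_sum) (auto simp: f_def finite_unit_steps)
    moreover have "f x \<le> 1" by (simp add: f_def indicator_def)
    ultimately have "f x \<le> (\<Sum>s\<in>unit_steps. f (x + s))" by linarith
    then show "1 / (2 * CARD('d)) * f x \<le> (\<Sum>s\<in>unit_steps. f (x + s)) / (2 * CARD('d))"
      by (simp add: divide_right_mono)
  qed (use assms e0 in \<open>auto simp: f_def indicator_def\<close>)
qed

lemma card_vec_Pi: "card {x :: 'a ^ 'd. \<forall>k. x $ k \<in> A k} = (\<Prod>k\<in>UNIV. card (A k))"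
  and finite_vec_Pi: "(\<And>k. finite (A k)) \<Longrightarrow> finite {x :: 'a ^ 'd. \<forall>k. x $ k \<in> A k}"
proof -
  have "bij_betw vec_nth {x :: 'a ^ 'd. \<forall>k. x $ k \<in> A k} (Pi\<^sub>E UNIV A)"
    by (rule bij_betwI[where g = vec_lambda]) auto
  then show "card {x :: 'a ^ 'd. \<forall>k. x $ k \<in> A k} = (\<Prod>k\<in>UNIV. card (A k))"
    and "(\<And>k. finite (A k)) \<Longrightarrow> finite {x :: 'a ^ 'd. \<forall>k. x $ k \<in> A k}"
    by (auto dest: bij_betw_same_card bij_betw_finite simp: card_PiE intro!: finite_PiE)
qed

lemma card_cube_le:
  assumes "R > 0"
  shows "finite {x :: int ^ 'd. \<forall>k. \<bar>x $ k - w $ k\<bar> < int R}"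
    and "card {x :: int ^ 'd. \<forall>k. \<bar>x $ k - w $ k\<bar> < int R} \<le> (2 * R) ^ CARD('d)"
proof -
  define A where "A k = {w $ k - int R <..< w $ k + int R}" for k
  have eq: "{x :: int ^ 'd. \<forall>k. \<bar>x $ k - w $ k\<bar> < int R} = {x. \<forall>k. x $ k \<in> A k}"
    unfolding A_def by (intro Collect_cong all_cong1) auto
  have "card (A k) = 2 * R - 1" for k
    by (simp add: A_def)
  then have "card {x. \<forall>k. x $ k \<in> A k} = (2 * R - 1) ^ CARD('d)"
    by (simp add: card_vec_Pi)
  also have "\<dots> \<le> (2 * R) ^ CARD('d)" by (intro power_mono) auto
  finally show "card {x :: int ^ 'd. \<forall>k. \<bar>x $ k - w $ k\<bar> < int R} \<le> (2 * R) ^ CARD('d)"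
    by (simp add: eq)
  show "finite {x :: int ^ 'd. \<forall>k. \<bar>x $ k - w $ k\<bar> < int R}"
    unfolding eq by (intro finite_vec_Pi) (simp add: A_def)
qed

lemma prob_ge_cube:
  fixes n R :: nat
  assumes p: "p > 1" and R: "R \<ge> 1"
    and A: "A < (real n + 1) powr p * ((2 * real R) ^ CARD('d)) powr (1 - p)"
  shows "cos (pi / (2 * R)) ^ n
     \<le> \<P>(\<omega> in srw_steps. (\<Sum>\<^sub>\<infinity>x::int^'d. real (local_time (walk \<omega>) n x) powr p) > A)"
proof -
  define K where "K = {x :: int ^ 'd. \<forall>k. \<bar>x $ k\<bar> < int R}"
  define \<theta> where "\<theta> = pi / (2 * R)"
  define c where "c x = (\<Prod>k\<in>UNIV. cos (\<theta> * x $ k))" for x :: "int ^ 'd"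
  define f where "f x = (if x \<in> K then c x else 0)" for x
  have th: "\<theta> > 0" "\<theta> * R = pi / 2" "\<theta> \<le> pi / 2"
    using R by (auto simp: \<theta>_def field_simps)
  have cos_nonneg: "cos (\<theta> * z) \<ge> 0" if "\<bar>z\<bar> \<le> int R" for z :: int
  proof -
    have "real_of_int \<bar>z\<bar> \<le> real R" using that by linarith
    then have "\<theta> * \<bar>real_of_int z\<bar> \<le> \<theta> * R"
      using th by (intro mult_left_mono) auto
    then have "\<bar>\<theta> * z\<bar> \<le> pi / 2"
      unfolding th(2) using th(1) by (simp add: abs_mult)
    then show ?thesis by (intro cos_ge_zero) auto
  qed
  \<comment> \<open>A neighbour of a point of \<open>K\<close> lies in \<open>K\<close> or has a
    coordinate \<open>R\<close> or \<open>-R\<close>. There the product of cosines vanishes by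
    itself, so the cut-off in \<open>f\<close> leaves the eigenvalue equation on \<open>K\<close>
    intact.\<close>
  have f_eq: "f x = c x" if "\<And>k. \<bar>x $ k\<bar> \<le> int R" for x
  proof (cases "x \<in> K")
    case False
    then obtain k where "\<not> \<bar>x $ k\<bar> < int R" by (auto simp: K_def)
    with that[of k] have "\<bar>x $ k\<bar> = int R" by simp
    then have "x $ k = int R \<or> x $ k = - int R" by linarith
    moreover have "cos (\<theta> * real R) = 0" unfolding th(2) by simp
    ultimately have "cos (\<theta> * x $ k) = 0" by auto
    then have "c x = 0" unfolding c_def by (intro prod_zero) auto
    then show ?thesis using False by (simp add: f_def)
  qed (simp add: f_def)
  have c_step: "c (x + axis i 1) + c (x - axis i 1) = 2 * cos \<theta> * c x" for x and i :: 'd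
  proof -
    define r where "r = (\<Prod>k\<in>UNIV - {i}. cos (\<theta> * x $ k))"
    have 1: "c y = cos (\<theta> * y $ i) * (\<Prod>k\<in>UNIV - {i}. cos (\<theta> * y $ k))" for y
      unfolding c_def by (rule prod.remove) auto
    have "(\<Prod>k\<in>UNIV - {i}. cos (\<theta> * (x + axis i 1) $ k)) = r"
      "(\<Prod>k\<in>UNIV - {i}. cos (\<theta> * (x - axis i 1) $ k)) = r"
      unfolding r_def by (intro prod.cong; simp add: axis_def)+
    then have "c (x + axis i 1) + c (x - axis i 1)
        = (cos (\<theta> * x $ i + \<theta>) + cos (\<theta> * x $ i - \<theta>)) * r"
      unfolding 1 by (simp add: algebra_simps axis_def)
    also have "\<dots> = 2 * cos \<theta> * c x"
      unfolding 1 r_def by (simp add: cos_add cos_diff)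
    finally show ?thesis .
  qed
  have fin: "finite K" and card_K: "card K \<le> (2 * R) ^ CARD('d)"
    using card_cube_le[of R 0] R by (auto simp: K_def)
  have "0 \<in> K" using R by (simp add: K_def)
  show ?thesis
    unfolding \<theta>_def[symmetric]
  proof (rule prob_ge_of_confinement[of K "cos \<theta>" f])
    fix x assume x: "x \<in> K"
    have near: "\<bar>(x + axis i 1) $ k\<bar> \<le> int R" "\<bar>(x - axis i 1) $ k\<bar> \<le> int R" for i k
    proof -
      have "\<bar>x $ k\<bar> < int R" using x by (simp add: K_def)
      moreover have "axis i (1::int) $ k = 0 \<or> axis i (1::int) $ k = 1" by (simp add: axis_def)
      ultimately show "\<bar>(x + axis i 1) $ k\<bar> \<le> int R" "\<bar>(x - axis i 1) $ k\<bar> \<le> int R" by auto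
    qed
    have nb: "f (x + axis i 1) = c (x + axis i 1)" "f (x - axis i 1) = c (x - axis i 1)" for i
      by (rule f_eq, rule near)+
    have "(\<Sum>s\<in>unit_steps. f (x + s)) = (\<Sum>i\<in>(UNIV :: 'd set). 2 * cos \<theta> * c x)"
      unfolding sum_unit_steps by (intro sum.cong) (use nb c_step in auto)
    then show "cos \<theta> * f x \<le> (\<Sum>s\<in>unit_steps. f (x + s)) / (2 * CARD('d))"
      using x by (simp add: f_def)
  next
    show "f x \<le> 1" for x
    proof (cases "x \<in> K")
      case True
      then have "c x \<le> 1" unfolding c_def
        by (intro prod_le_1) (auto simp: K_def intro!: cos_nonneg intro: less_imp_le)
      then show ?thesis by (simp add: f_def)
    qed (simp add: f_def)
    show "f 0 = 1" using \<open>0 \<in> K\<close> by (simp add: f_def c_def)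
    show "cos \<theta> \<ge> 0" using th by (intro cos_ge_zero) auto
    have "card K > 0" using fin \<open>0 \<in> K\<close> by (auto simp: card_gt_0_iff)
    then have "((2 * real R) ^ CARD('d)) powr (1 - p) \<le> real (card K) powr (1 - p)"
      using p card_K by (intro powr_mono2')
        (auto simp: of_nat_le_iff[symmetric, where 'a = real] simp del: of_nat_le_iff)
    then have "(real n + 1) powr p * ((2 * real R) ^ CARD('d)) powr (1 - p)
        \<le> (real n + 1) powr p * real (card K) powr (1 - p)"
      by (intro mult_left_mono) auto
    with A show "A < (real n + 1) powr p * real (card K) powr (1 - p)"
      by linarith
  qed (use fin p in \<open>auto simp: f_def\<close>)
qed

section \<open>A superharmonic majorant of the Green kernel\<close>

text \<open>The strict inequality makes the cube of scale 0 the single site \<open>w\<close>, so an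
  occupation bound at scale 0 is a bound on the local time.\<close>

definition cube :: "int ^ 'd \<Rightarrow> nat \<Rightarrow> (int ^ 'd) set" where
  "cube w i = {x. \<forall>k. \<bar>x $ k - w $ k\<bar> < 2 ^ i}"

lemma finite_cube: "finite (cube w i)"
  and card_cube: "card (cube w i) \<le> (2 ^ CARD('d)) * (2 ^ CARD('d)) ^ i"
  for w :: "int ^ 'd"
proof -
  have "cube w i = {x. \<forall>k. \<bar>x $ k - w $ k\<bar> < int (2 ^ i)}" by (simp add: cube_def)
  then show "finite (cube w i)" using card_cube_le(1)[of "2 ^ i" w] by simp
  have "card (cube w i) \<le> (2 * 2 ^ i) ^ CARD('d)"
    using card_cube_le(2)[of "2 ^ i" w] by (simp add: cube_def)
  also have "\<dots> = (2 ^ CARD('d)) * (2 ^ CARD('d)) ^ i"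
    by (simp add: power_mult_distrib mult.commute flip: power_mult)
  finally show "card (cube w i) \<le> (2 ^ CARD('d)) * (2 ^ CARD('d)) ^ i" .
qed

lemma cube_mono: "i \<le> j \<Longrightarrow> cube w i \<subseteq> cube w j"
  by (auto simp: cube_def) (meson less_le_trans one_le_numeral power_increasing)

lemma cube_0: "cube w 0 = {w}"
  by (auto simp: cube_def vec_eq_iff)

text \<open>Taylor expansion to fourth order for a pair of opposite steps: the odd terms cancel. The
  bound 1/2 keeps \<open>1 - z\<close> away from the singularity, and the factor 2 / 4! of the
  quartic term is estimated by 1.\<close>

lemma powr_symmetric_sum_le:
  fixes \<beta> z :: real
  assumes "\<beta> > 0" "\<bar>z\<bar> \<le> 1 / 2"
  shows "(1 + z) powr (-\<beta>) + (1 - z) powr (-\<beta>)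
    \<le> 2 + \<beta> * (\<beta> + 1) * z\<^sup>2 + \<beta> * (\<beta> + 1) * (\<beta> + 2) * (\<beta> + 3) * (1 / 2) powr (-\<beta> - 4) * z ^ 4"
    (is "?f z \<le> ?g z")
proof -
  have pos: "?f z \<le> ?g z" if z: "0 < z" "z \<le> 1 / 2" for z
  proof -
    define c where "c m = (\<Prod>i<m. - \<beta> - real i)" for m :: nat
    define D where "D m t = c m * ((1 + t) powr (- \<beta> - real m) + (-1) ^ m * (1 - t) powr (- \<beta> - real m))"
      for m :: nat and t :: real
    have "\<forall>m t. m < 4 \<and> 0 \<le> t \<and> t \<le> z \<longrightarrow> DERIV (D m) t :> D (Suc m) t"
    proof (intro allI impI)
      fix m :: nat and t assume t: "m < 4 \<and> 0 \<le> t \<and> t \<le> z"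
      then have "0 < 1 + t" "0 < 1 - t" using z by auto
      then show "DERIV (D m) t :> D (Suc m) t"
        unfolding D_def
        by (auto intro!: derivative_eq_intros simp: c_def algebra_simps)
    qed
    moreover have "D 0 = ?f" by (simp add: D_def c_def fun_eq_iff)
    ultimately obtain t where t: "0 < t" "t < z"
      and eq: "?f z = (\<Sum>m<4. (D m 0 / fact m) * (z - 0) ^ m) + (D 4 t / fact 4) * (z - 0) ^ 4"
      using Taylor_up[of 4 D ?f 0 z 0] z by auto
    have c4: "c 4 = \<beta> * (\<beta> + 1) * (\<beta> + 2) * (\<beta> + 3)"
      by (simp add: c_def numeral_eq_Suc algebra_simps)
    have "w powr (- \<beta> - 4) \<le> (1 / 2) powr (- \<beta> - 4)" if "1 / 2 \<le> w" for w
      using that assms by (intro powr_mono2') auto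
    then have "(1 + t) powr (- \<beta> - 4) + (1 - t) powr (- \<beta> - 4) \<le> 2 * (1 / 2) powr (- \<beta> - 4)"
      using t z by (simp only: mult_2) (intro add_mono; force)
    then have "D 4 t \<le> c 4 * (2 * (1 / 2) powr (- \<beta> - 4))"
      unfolding D_def using assms by (intro mult_left_mono) (auto simp: c4)
    also have "\<dots> \<le> c 4 * (1 / 2) powr (- \<beta> - 4) * fact 4"
      using assms by (simp add: c4 fact_numeral)
    finally have "(D 4 t / fact 4) * z ^ 4 \<le> c 4 * (1 / 2) powr (- \<beta> - 4) * z ^ 4"
      using z by (intro mult_right_mono) (auto simp: field_simps)
    moreover have "(\<Sum>m<4. (D m 0 / fact m) * z ^ m) = 2 + \<beta> * (\<beta> + 1) * z\<^sup>2"
      by (simp add: D_def c_def numeral_eq_Suc power2_eq_square algebra_simps)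
    ultimately show ?thesis unfolding eq c4 by simp
  qed
  consider "z = 0" | "z > 0" | "z < 0" by linarith
  then show ?thesis
  proof cases
    case 3
    then show ?thesis using pos[of "- z"] assms by (simp add: add.commute)
  qed (use pos assms in auto)
qed

text \<open>
  Only superharmonicity and the order of decay of the Green kernel matter, so it can be replaced by an
  explicit function: \<open>(A + |x|\<^sup>2) powr (1 - d / 2)\<close> is superharmonic on the lattice once \<open>A\<close> is large,
  as the lattice correction to the Laplacian is of lower order.
\<close>

lemma ex_green_majorant:
  assumes d3: "CARD('d) \<ge> 3"
  obtains G :: "int ^ 'd \<Rightarrow> real" and C where
    "\<And>x. G x \<ge> 0"
    "\<And>x. (\<Sum>s\<in>unit_steps. G (x + s)) / (2 * CARD('d)) \<le> G x - of_bool (x = 0)"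
    "C > 0" "\<And>x. G x \<le> C" "\<And>x i. x \<notin> cube 0 i \<Longrightarrow> G x \<le> C * (1 / 2 ^ (CARD('d) - 2)) ^ i"
proof -
  define d where "d = real CARD('d)"
  \<comment> \<open>With this exponent \<open>2 * (\<beta> + 1) = d\<close>, so the second-order
    terms average to exactly \<open>\<beta> * N x / y\<^sup>2\<close>.\<close>
  define \<beta> where "\<beta> = (d - 2) / 2"
  have d: "d \<ge> 3" using d3 by (simp add: d_def)
  have b: "\<beta> > 0" "2 * (\<beta> + 1) = d" using d by (auto simp: \<beta>_def field_simps)
  define C where "C = \<beta> * (\<beta> + 1) * (\<beta> + 2) * (\<beta> + 3) * (1 / 2) powr (-\<beta> - 4)"
  define \<delta> :: real where "\<delta> = 1 / 2"
  have C: "C \<ge> 0" "\<delta> > 0" "\<delta> < 1" using b by (auto simp: C_def \<delta>_def)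
  have tay: "\<And>z. \<bar>z\<bar> \<le> \<delta> \<Longrightarrow> (1 + z) powr (-\<beta>) + (1 - z) powr (-\<beta>) \<le> 2 + \<beta> * (\<beta> + 1) * z\<^sup>2 + C * z ^ 4"
    unfolding C_def \<delta>_def by (rule powr_symmetric_sum_le[OF b(1)])
  \<comment> \<open>The second summand makes the quartic error smaller than the gain
    \<open>\<beta> * (A + 1)\<close>; the third keeps the relative increments \<open>z i\<close>
    within \<open>\<delta>\<close>.\<close>
  define A where "A = 1 + 8 * C / (d * \<beta>) + 1 / \<delta>\<^sup>2"
  have A1: "A \<ge> 1" "A + 1 \<ge> 1 / \<delta>\<^sup>2" using C b d by (auto simp: A_def)
  have "8 * C / d = \<beta> * (8 * C / (d * \<beta>))" using b d by (simp add: field_simps)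
  also have "\<dots> < \<beta> * (A + 1)"
    using b C by (intro mult_strict_left_mono) (auto simp: A_def add_pos_nonneg)
  finally have A2: "8 * C / d < \<beta> * (A + 1)" .
  define N where "N x = (\<Sum>k\<in>UNIV. (real_of_int (x $ k))\<^sup>2)" for x :: "int ^ 'd"
  define H where "H x = (A + N x) powr (-\<beta>)" for x :: "int ^ 'd"
  have N0: "N x \<ge> 0" for x by (auto simp: N_def intro: sum_nonneg)
  have Nk: "(real_of_int (x $ k))\<^sup>2 \<le> N x" for x k
    unfolding N_def by (rule member_le_sum) auto
  have N_step: "N (x + axis i 1) = N x + 2 * x $ i + 1" "N (x - axis i 1) = N x - 2 * x $ i + 1" for x i
  proof -
    have "(real_of_int ((x + axis i 1) $ k))\<^sup>2 = (real_of_int (x $ k))\<^sup>2 + (if k = i then 2 * real_of_int (x $ i) + 1 else 0)"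
         "(real_of_int ((x - axis i 1) $ k))\<^sup>2 = (real_of_int (x $ k))\<^sup>2 + (if k = i then 1 - 2 * real_of_int (x $ i) else 0)" for k
      by (auto simp: axis_def power2_eq_square algebra_simps)
    then show "N (x + axis i 1) = N x + 2 * x $ i + 1" "N (x - axis i 1) = N x - 2 * x $ i + 1"
      unfolding N_def by (simp_all add: sum.distrib)
  qed
  have gap: "(\<Sum>s\<in>unit_steps. H (x + s)) / (2 * d) < H x" for x
  proof -
    \<comment> \<open>\<open>y\<close> is the mean of \<open>A + N\<close> over the neighbours of
      \<open>x\<close>; opposite neighbours have the values \<open>y * (1 + z i)\<close> and
      \<open>y * (1 - z i)\<close>.\<close>
    define y where "y = A + 1 + N x"
    define z where "z i = 2 * real_of_int (x $ i) / y" for i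
    have y: "y \<ge> 2" "y > 0" using A1 N0[of x] by (auto simp: y_def)
    have z_small: "\<bar>z i\<bar> \<le> \<delta>" for i
    proof -
      let ?v = "\<bar>real_of_int (x $ i)\<bar>"
      have "0 \<le> (\<delta> * ?v - 1)\<^sup>2" by simp
      then have "2 * \<delta> * ?v \<le> 1 + \<delta>\<^sup>2 * ?v\<^sup>2" by (simp add: power2_eq_square algebra_simps)
      also have "\<dots> \<le> \<delta>\<^sup>2 * (A + 1) + \<delta>\<^sup>2 * N x"
      proof (rule add_mono)
        show "1 \<le> \<delta>\<^sup>2 * (A + 1)" using A1(2) C by (simp add: field_simps)
        show "\<delta>\<^sup>2 * ?v\<^sup>2 \<le> \<delta>\<^sup>2 * N x" using Nk[of x i] by (intro mult_left_mono) auto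
      qed
      also have "\<dots> = \<delta> * (\<delta> * y)" by (simp add: y_def power2_eq_square algebra_simps)
      finally have "\<delta> * (2 * ?v) \<le> \<delta> * (\<delta> * y)" by (simp add: mult_ac)
      then have "2 * ?v \<le> \<delta> * y" using C by simp
      then show ?thesis using y by (simp add: z_def field_simps)
    qed
    have two: "H (x + axis i 1) + H (x - axis i 1) \<le> y powr (-\<beta>) * (2 + \<beta> * (\<beta> + 1) * (z i)\<^sup>2 + C * (z i) ^ 4)" for i
    proof -
      have "A + N (x + axis i 1) = y * (1 + z i)" "A + N (x - axis i 1) = y * (1 - z i)"
        using y by (simp_all add: N_step z_def y_def field_simps)
      moreover have "(y * (1 + z i)) powr (-\<beta>) = y powr (-\<beta>) * (1 + z i) powr (-\<beta>)"
        "(y * (1 - z i)) powr (-\<beta>) = y powr (-\<beta>) * (1 - z i) powr (-\<beta>)"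
        using y z_small[of i] C by (auto intro!: powr_mult)
      ultimately have "H (x + axis i 1) + H (x - axis i 1)
          = y powr (-\<beta>) * ((1 + z i) powr (-\<beta>) + (1 - z i) powr (-\<beta>))"
        by (simp only: H_def distrib_left)
      also have "\<dots> \<le> y powr (-\<beta>) * (2 + \<beta> * (\<beta> + 1) * (z i)\<^sup>2 + C * (z i) ^ 4)"
        by (intro mult_left_mono tay z_small) auto
      finally show ?thesis .
    qed
    have z2: "(\<Sum>i\<in>UNIV. (z i)\<^sup>2) = 4 * N x / y\<^sup>2"
      by (simp add: z_def N_def power_divide power_mult_distrib sum_divide_distrib sum_distrib_left)
    have z4: "(\<Sum>i\<in>UNIV. (z i) ^ 4) \<le> 16 / y\<^sup>2"
    proof -
      have "(z i)\<^sup>2 \<le> 4 / y" for i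
      proof -
        have "(z i)\<^sup>2 = 4 * (real_of_int (x $ i))\<^sup>2 / y\<^sup>2" by (simp add: z_def power_divide power_mult_distrib)
        also have "\<dots> \<le> 4 * y / y\<^sup>2"
          using Nk[of x i] A1 by (intro divide_right_mono) (auto simp: y_def)
        also have "\<dots> = 4 / y" using y by (simp add: power2_eq_square)
        finally show ?thesis .
      qed
      then have "(\<Sum>i\<in>UNIV. (z i)\<^sup>2 * (z i)\<^sup>2) \<le> (\<Sum>i\<in>UNIV. 4 / y * (z i)\<^sup>2)"
        by (intro sum_mono mult_right_mono) auto
      also have "\<dots> = 4 / y * (4 * N x / y\<^sup>2)" by (simp only: sum_distrib_left[symmetric] z2)
      also have "\<dots> \<le> 4 / y * (4 * y / y\<^sup>2)"
        using y A1 by (intro mult_left_mono divide_right_mono) (auto simp: y_def)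
      also have "\<dots> = 16 / y\<^sup>2" using y by (simp add: power2_eq_square)
      finally show ?thesis by (simp add: power2_eq_square power4_eq_xxxx mult_ac)
    qed
    have "(\<Sum>s\<in>unit_steps. H (x + s)) = (\<Sum>i\<in>UNIV. H (x + axis i 1) + H (x - axis i 1))"
      by (simp add: sum_unit_steps)
    also have "\<dots> \<le> (\<Sum>i\<in>UNIV. y powr (-\<beta>) * (2 + \<beta> * (\<beta> + 1) * (z i)\<^sup>2 + C * (z i) ^ 4))"
      by (intro sum_mono two)
    also have "\<dots> = y powr (-\<beta>) * (2 * d + \<beta> * (\<beta> + 1) * (\<Sum>i\<in>UNIV. (z i)\<^sup>2) + C * (\<Sum>i\<in>UNIV. (z i) ^ 4))"
      by (simp add: sum_distrib_left[symmetric] sum.distrib d_def)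
    also have "\<dots> \<le> y powr (-\<beta>) * (2 * d + \<beta> * (\<beta> + 1) * (4 * N x / y\<^sup>2) + C * (16 / y\<^sup>2))"
      unfolding z2 using z4 C by (intro mult_left_mono add_left_mono) auto
    finally have "(\<Sum>s\<in>unit_steps. H (x + s)) / (2 * d) \<le>
        y powr (-\<beta>) * (2 * d + \<beta> * (\<beta> + 1) * (4 * N x / y\<^sup>2) + C * (16 / y\<^sup>2)) / (2 * d)"
      using d by (intro divide_right_mono) auto
    also have "\<dots> = y powr (-\<beta>) * (1 + (\<beta> * N x + 8 * C / d) / y\<^sup>2)"
    proof -
      have "\<beta> * (\<beta> + 1) * (4 * N x / y\<^sup>2) = 2 * d * (\<beta> * N x / y\<^sup>2)"
        unfolding b(2)[symmetric] by (simp add: mult_ac)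
      moreover have "C * (16 / y\<^sup>2) = 2 * d * (8 * C / d / y\<^sup>2)"
        using d by simp
      ultimately have "2 * d + \<beta> * (\<beta> + 1) * (4 * N x / y\<^sup>2) + C * (16 / y\<^sup>2)
          = 2 * d * (1 + (\<beta> * N x + 8 * C / d) / y\<^sup>2)"
        by (simp only: distrib_left add_divide_distrib mult_1_right add.assoc)
      then show ?thesis using d by simp
    qed
    also have "\<dots> < y powr (-\<beta>) * (1 + \<beta> / y)"
    proof -
      have "\<beta> * N x + 8 * C / d < \<beta> * y" using A2 by (simp add: y_def algebra_simps)
      then have "(\<beta> * N x + 8 * C / d) / y\<^sup>2 < \<beta> * y / y\<^sup>2"
        using y by (intro divide_strict_right_mono) auto
      then show ?thesis using y by (simp add: power2_eq_square)
    qed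
    \<comment> \<open>Returns from the mean \<open>y\<close> to the value
      \<open>A + N x = y * (1 - 1 / y)\<close> at \<open>x\<close> itself.\<close>
    also have "\<dots> \<le> y powr (-\<beta>) * (1 - 1 / y) powr (-\<beta>)"
    proof (rule mult_left_mono)
      have "1 + \<beta> / y \<le> exp (\<beta> / y)" by (rule exp_ge_add_one_self)
      also have "\<dots> = exp (- 1 / y) powr (-\<beta>)" by (simp add: exp_powr_real)
      also have "\<dots> \<le> (1 - 1 / y) powr (-\<beta>)"
        using exp_ge_add_one_self[of "- 1 / y"] y b by (intro powr_mono2') auto
      finally show "1 + \<beta> / y \<le> (1 - 1 / y) powr (-\<beta>)" .
    qed auto
    also have "\<dots> = (y * (1 - 1 / y)) powr (-\<beta>)" using y by (simp add: powr_mult)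
    also have "y * (1 - 1 / y) = A + N x" using y(2) by (simp add: right_diff_distrib) (simp add: y_def)
    also have "\<dots> powr (-\<beta>) = H x" by (simp add: H_def)
    finally show ?thesis .
  qed
  \<comment> \<open>\<open>H\<close> is strictly superharmonic everywhere; dividing by its defect at
    the origin produces the unit source there.\<close>
  define c where "c = H 0 - (\<Sum>s\<in>unit_steps. H (0 + s)) / (2 * d)"
  have c: "c > 0" using gap[of 0] by (simp add: c_def)
  define G where "G x = H x / c" for x
  have H1: "H x \<le> 1" for x
    using powr_mono2'[of "-\<beta>" 1 "A + N x"] A1 N0[of x] b by (simp add: H_def)
  show ?thesis
  proof (rule that[of G "1 / c"])
    fix x :: "int ^ 'd"
    show "G x \<ge> 0" using c by (simp add: G_def H_def)
    show "1 / c > 0" using c by simp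
    show "G x \<le> 1 / c" using H1 c by (simp add: G_def divide_right_mono)
    have "c * of_bool (x = 0) \<le> H x - (\<Sum>s\<in>unit_steps. H (x + s)) / (2 * d)"
      using gap[of x] by (auto simp: c_def)
    then have "c * of_bool (x = 0) / c \<le> (H x - (\<Sum>s\<in>unit_steps. H (x + s)) / (2 * d)) / c"
      using c by (intro divide_right_mono) auto
    then show "(\<Sum>s\<in>unit_steps. G (x + s)) / (2 * CARD('d)) \<le> G x - of_bool (x = 0)"
      using c by (simp add: G_def sum_divide_distrib[symmetric] d_def diff_divide_distrib mult_ac)
    fix i assume "x \<notin> cube 0 i"
    then obtain k where "\<bar>x $ k\<bar> \<ge> 2 ^ i" by (auto simp: cube_def not_less)
    then have "(2::real) ^ i \<le> \<bar>real_of_int (x $ k)\<bar>"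
      by (metis of_int_abs of_int_le_iff of_int_numeral of_int_power)
    then have "((2::real) ^ i)\<^sup>2 \<le> \<bar>real_of_int (x $ k)\<bar>\<^sup>2"
      by (intro power_mono) auto
    also have "\<dots> \<le> A + N x" using Nk[of x k] A1 by simp
    finally have "H x \<le> (((2::real) ^ i)\<^sup>2) powr (-\<beta>)"
      unfolding H_def using b by (intro powr_mono2') auto
    also have "\<dots> = (1 / 2 ^ (CARD('d) - 2)) ^ i"
    proof -
      have "(((2::real) ^ i)\<^sup>2) powr (-\<beta>) = 2 powr (- (real i * (d - 2)))"
        by (simp add: powr_realpow[symmetric] powr_powr \<beta>_def flip: power_mult)
      also have "real i * (d - 2) = real (i * (CARD('d) - 2))"
        using d3 by (simp add: d_def of_nat_diff)
      also have "2 powr (- real (i * (CARD('d) - 2))) = 1 / 2 ^ (i * (CARD('d) - 2))"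
        by (simp add: powr_minus powr_realpow divide_inverse del: of_nat_mult)
      finally show ?thesis by (simp add: power_one_over mult.commute flip: power_mult)
    qed
    finally show "G x \<le> 1 / c * (1 / 2 ^ (CARD('d) - 2)) ^ i"
      using c by (simp add: G_def divide_right_mono)
  qed
qed

section \<open>The exponential supermartingale\<close>

fun path_sum :: "((int ^ 'd) list \<Rightarrow> real) \<Rightarrow> (int ^ 'd) list \<Rightarrow> real" where
  "path_sum f [] = f []"
| "path_sum f (s # xs) = path_sum f xs + f (s # xs)"

text \<open>\<open>G_decay\<close> is the decay |x|^(2 - d) of the Green kernel, read off at the
  radius 2^i.\<close>

locale green_majorant =
  fixes G :: "int ^ 'd \<Rightarrow> real" and C :: real
  assumes dim: "CARD('d) \<ge> 3"
    and G_nonneg: "G x \<ge> 0"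
    and G_super: "(\<Sum>s\<in>unit_steps. G (x + s)) / (2 * CARD('d)) \<le> G x - of_bool (x = 0)"
    and C_pos: "C > 0"
    and G_le: "G x \<le> C"
    and G_decay: "x \<notin> cube 0 i \<Longrightarrow> G x \<le> C * (1 / 2 ^ (CARD('d) - 2)) ^ i"
begin

lemma G0_ge_1: "G 0 \<ge> 1"
proof -
  have "0 \<le> (\<Sum>s\<in>unit_steps. G (0 + s)) / (2 * CARD('d))"
    by (intro divide_nonneg_nonneg sum_nonneg G_nonneg) auto
  also have "\<dots> \<le> G 0 - 1" using G_super[of 0] by simp
  finally show ?thesis by simp
qed

text \<open>
  Khas'minskii's exponential moment bound for a weight \<open>F\<close> that is allowed to grow by \<open>D\<close> at the
  current position of the walk: with \<open>h = G F\<close> the potential, \<open>1 + h / L\<close> times the exponential is a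
  supermartingale as long as \<open>h \<le> L\<close>, since a step lowers \<open>h\<close> by \<open>F\<close> on average while growth of
  \<open>F\<close> raises it by \<open>G 0 * D\<close>.
\<close>

lemma avg_exp_path_sum_le:
  fixes F :: "(int ^ 'd) list \<Rightarrow> int ^ 'd \<Rightarrow> real" and D :: "(int ^ 'd) list \<Rightarrow> real"
  assumes Y: "finite Y" and L: "L > 0"
    and F_nonneg: "\<And>xs y. F xs y \<ge> 0" and D_nonneg: "\<And>xs. D xs \<ge> 0"
    and F_Cons: "\<And>s xs y. F (s # xs) y = F xs y + (if y = sum_list (s # xs) then D (s # xs) else 0)"
    and good: "\<And>xs. good xs \<Longrightarrow> (\<Sum>y\<in>Y. G (sum_list xs - y) * F xs y) \<le> L"
    and good_Cons: "\<And>s xs. good (s # xs) \<Longrightarrow> good xs"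
  shows "avg n (\<lambda>xs. of_bool (good xs) * exp (path_sum (\<lambda>xs.
      (if sum_list xs \<in> Y then F xs (sum_list xs) else 0) / 2 - G 0 * D xs) xs / L)) \<le> 4"
proof -
  define cur where "cur xs = (if sum_list xs \<in> Y then F xs (sum_list xs) else 0)" for xs
  define h where "h xs z = (\<Sum>y\<in>Y. G (z - y) * F xs y)" for xs z
  define P where "P = path_sum (\<lambda>xs. cur xs / 2 - G 0 * D xs)"
  \<comment> \<open>The current site is left out of the exponent: its term is paid for by the next
    step, which lowers the potential by \<open>cur\<close> on average.\<close>
  define E where "E xs = (P xs - cur xs / 2) / L" for xs
  define W where "W xs = (1 + h xs (sum_list xs) / L) * exp (E xs)" for xs
  have cur0: "cur xs \<ge> 0" for xs by (simp add: cur_def F_nonneg)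
  have h0: "h xs z \<ge> 0" for xs z by (auto simp: h_def intro!: sum_nonneg mult_nonneg_nonneg G_nonneg F_nonneg)
  have h_good: "h xs (sum_list xs) \<le> L" if "good xs" for xs
    using good[OF that] by (simp add: h_def)
  have W0: "W xs \<ge> 0" for xs using h0 L by (simp add: W_def)
  have h_Cons: "h (s # xs) (sum_list (s # xs)) \<le> h xs (sum_list (s # xs)) + G 0 * D (s # xs)" for s xs
  proof -
    let ?z = "sum_list (s # xs)"
    have "h (s # xs) ?z = h xs ?z + (\<Sum>y\<in>Y. if y = ?z then G (?z - y) * D (s # xs) else 0)"
      unfolding h_def F_Cons sum.distrib[symmetric] by (intro sum.cong) (auto simp: distrib_left)
    also have "(\<Sum>y\<in>Y. if y = ?z then G (?z - y) * D (s # xs) else 0) \<le> G 0 * D (s # xs)"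
      using Y by (simp add: G_nonneg D_nonneg)
    finally show ?thesis by simp
  qed
  have W_Cons: "W (s # xs) \<le> (1 + h xs (sum_list xs + s) / L) * exp (E xs + cur xs / (2 * L))" for s xs
  proof -
    let ?z = "sum_list (s # xs)" and ?D = "G 0 * D (s # xs)"
    have D: "?D \<ge> 0" by (intro mult_nonneg_nonneg G_nonneg D_nonneg)
    have "1 + h (s # xs) ?z / L \<le> 1 + (h xs ?z + ?D) / L"
      using h_Cons L by (intro add_left_mono divide_right_mono) auto
    also have "\<dots> \<le> (1 + h xs ?z / L) * (1 + ?D / L)"
    proof -
      have "h xs ?z / L * (?D / L) \<ge> 0"
        by (rule mult_nonneg_nonneg; rule divide_nonneg_pos) (fact h0 D L)+
      then show ?thesis by (simp add: distrib_left distrib_right add_divide_distrib)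
    qed
    also have "\<dots> \<le> (1 + h xs ?z / L) * exp (?D / L)"
      using h0[of xs ?z] L by (intro mult_left_mono exp_ge_add_one_self) auto
    finally have 1: "1 + h (s # xs) ?z / L \<le> (1 + h xs ?z / L) * exp (?D / L)" .
    have E: "E (s # xs) = E xs + cur xs / (2 * L) - ?D / L"
      using L by (simp add: E_def P_def diff_divide_distrib add_divide_distrib)
    have "W (s # xs) \<le> (1 + h xs ?z / L) * exp (?D / L) * exp (E (s # xs))"
      unfolding W_def using 1 by (intro mult_right_mono) auto
    also have "\<dots> = (1 + h xs ?z / L) * exp (E xs + cur xs / (2 * L))"
      by (simp add: E mult.assoc flip: exp_add)
    finally show ?thesis by (simp add: add.commute)
  qed
  have h_step: "(\<Sum>s\<in>unit_steps. h xs (sum_list xs + s)) / (2 * CARD('d)) \<le> h xs (sum_list xs) - cur xs" for xs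
  proof -
    have "(\<Sum>s\<in>unit_steps. h xs (sum_list xs + s)) / (2 * CARD('d))
      = (\<Sum>y\<in>Y. ((\<Sum>s\<in>unit_steps. G (sum_list xs - y + s)) / (2 * CARD('d))) * F xs y)"
      unfolding h_def by (subst sum.swap) (simp add: sum_distrib_right sum_distrib_left sum_divide_distrib algebra_simps)
    also have "\<dots> \<le> (\<Sum>y\<in>Y. (G (sum_list xs - y) - of_bool (sum_list xs - y = 0)) * F xs y)"
      by (intro sum_mono mult_right_mono G_super F_nonneg)
    also have "\<dots> = h xs (sum_list xs) - (\<Sum>y\<in>Y. if y = sum_list xs then F xs y else 0)"
      unfolding h_def sum_subtractf[symmetric] by (intro sum.cong) (auto simp: algebra_simps)
    also have "\<dots> = h xs (sum_list xs) - cur xs"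
      using Y by (simp add: cur_def)
    finally show ?thesis .
  qed
  have card_U: "(\<Sum>s\<in>(unit_steps :: (int ^ 'd) set). 1 :: real) = 2 * CARD('d)"
    by (simp add: card_unit_steps)
  have W_step: "(\<Sum>s\<in>unit_steps. W (s # xs)) / (2 * CARD('d)) \<le> W xs" if "good xs" for xs
  proof -
    let ?h = "h xs (sum_list xs)" and ?c = "cur xs"
    have "(\<Sum>s\<in>unit_steps. W (s # xs)) / (2 * CARD('d))
      \<le> (\<Sum>s\<in>unit_steps. (1 + h xs (sum_list xs + s) / L) * exp (E xs + ?c / (2 * L))) / (2 * CARD('d))"
      by (intro divide_right_mono sum_mono W_Cons) auto
    also have "\<dots> = (1 + (\<Sum>s\<in>unit_steps. h xs (sum_list xs + s)) / (2 * CARD('d)) / L) * exp (E xs + ?c / (2 * L))"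
      unfolding sum_distrib_right[symmetric] sum.distrib card_U sum_divide_distrib[symmetric]
      by (simp add: field_simps)
    also have "\<dots> \<le> (1 + (?h - ?c) / L) * exp (E xs + ?c / (2 * L))"
      using L by (intro mult_right_mono add_left_mono divide_right_mono h_step) auto
    also have "\<dots> \<le> ((1 + ?h / L) * exp (- (?c / (2 * L)))) * exp (E xs + ?c / (2 * L))"
    proof (rule mult_right_mono)
      \<comment> \<open>Here \<open>h \<le> L\<close> enters, and here the weight has to be halved:
        the claim amounts to \<open>(1 + h / L) / 2\<close> being at most 1.\<close>
      have "?h * ?c \<le> L * ?c" using h_good[OF that] cur0 by (intro mult_right_mono)
      then have "1 + (?h - ?c) / L \<le> (1 + ?h / L) * (1 - ?c / (2 * L))"
        using L by (simp add: field_simps power2_eq_square)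
      also have "\<dots> \<le> (1 + ?h / L) * exp (- (?c / (2 * L)))"
        using exp_ge_add_one_self[of "- (?c / (2 * L))"] h0[of xs "sum_list xs"] L
        by (intro mult_left_mono) auto
      finally show "1 + (?h - ?c) / L \<le> (1 + ?h / L) * exp (- (?c / (2 * L)))" .
    qed auto
    also have "\<dots> = W xs"
      by (simp add: W_def mult.assoc flip: exp_add)
    finally show ?thesis .
  qed
  have main: "avg n (\<lambda>xs. of_bool (good xs) * W xs) \<le> 2"
  proof (induction n)
    case 0
    have "W [] \<le> 2" if "good []"
    proof -
      have "G 0 * D [] / L \<ge> 0" using L by (intro divide_nonneg_pos mult_nonneg_nonneg G_nonneg D_nonneg)
      then have "E [] \<le> 0" by (simp add: E_def P_def)
      moreover have "1 + h [] 0 / L \<le> 2" using h_good[OF that] L by simp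
      ultimately show ?thesis
        unfolding W_def using h0[of "[]" 0] L mult_mono[of "1 + h [] 0 / L" 2 "exp (E [])" 1] by simp
    qed
    then show ?case by simp
  next
    case (Suc n)
    have "avg (Suc n) (\<lambda>xs. of_bool (good xs) * W xs) \<le> avg n (\<lambda>xs. of_bool (good xs) * W xs)"
      unfolding avg.simps
    proof (rule avg_mono)
      fix xs
      \<comment> \<open>Weakening \<open>good (s # xs)\<close> to \<open>good xs\<close> plays the
        role of stopping when \<open>good\<close> first fails.\<close>
      have "(\<Sum>s\<in>unit_steps. of_bool (good (s # xs)) * W (s # xs)) / (2 * CARD('d))
          \<le> (\<Sum>s\<in>unit_steps. of_bool (good xs) * W (s # xs)) / (2 * CARD('d))"
        using good_Cons W0 by (intro divide_right_mono sum_mono mult_right_mono) auto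
      also have "\<dots> \<le> of_bool (good xs) * W xs"
        using W_step[of xs] by (cases "good xs") auto
      finally show "(\<Sum>s\<in>unit_steps. of_bool (good (s # xs)) * W (s # xs)) / (2 * CARD('d))
          \<le> of_bool (good xs) * W xs" .
    qed
    with Suc show ?case by linarith
  qed
  \<comment> \<open>Restores the omitted term: \<open>cur \<le> G 0 * cur \<le> h \<le> L\<close>
    bounds it by 1/2 in the exponent, hence by a factor 2, and the final constant is 2 * 2.\<close>
  have "exp (P xs / L) \<le> 2 * W xs" if "good xs" for xs
  proof -
    have "cur xs \<le> G 0 * cur xs" using G0_ge_1 cur0[of xs] mult_right_mono by fastforce
    also have "\<dots> \<le> h xs (sum_list xs)"
    proof (cases "sum_list xs \<in> Y")
      case True
      have "G (sum_list xs - sum_list xs) * F xs (sum_list xs) \<le> h xs (sum_list xs)"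
        unfolding h_def by (rule member_le_sum[OF True])
          (use Y in \<open>auto intro!: mult_nonneg_nonneg G_nonneg F_nonneg\<close>)
      then show ?thesis using True by (simp add: cur_def)
    qed (use h0 in \<open>simp add: cur_def\<close>)
    also have "\<dots> \<le> L" by (rule h_good[OF that])
    finally have "P xs / L \<le> E xs + 1 / 2" using L by (simp add: E_def field_simps)
    then have "exp (P xs / L) \<le> exp (E xs) * exp (1 / 2)" by (simp flip: exp_add)
    also have "\<dots> \<le> W xs * 2"
    proof (rule mult_mono)
      show "exp (E xs) \<le> W xs" unfolding W_def using h0[of xs "sum_list xs"] L by (simp add: field_simps)
      have "exp (1 / 2 :: real) ^ 2 \<le> 2 ^ 2"
        using exp_le by (simp add: power2_eq_square flip: exp_add)
      then show "exp (1 / 2 :: real) \<le> 2" by (rule power2_le_imp_le) auto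
    qed (use W0 in auto)
    finally show ?thesis by simp
  qed
  then have "avg n (\<lambda>xs. of_bool (good xs) * exp (P xs / L)) \<le> avg n (\<lambda>xs. 2 * (of_bool (good xs) * W xs))"
    by (intro avg_mono) auto
  also have "\<dots> \<le> 4" unfolding avg_cmult using main by simp
  finally show ?thesis by (simp add: P_def cur_def)
qed

section \<open>Dyadic estimates for Green potentials\<close>

lemma G_le_dyadic:
  assumes "x \<in> cube 0 J"
  shows "G x \<le> C * 2 ^ (CARD('d) - 2) * (\<Sum>j\<le>J. of_bool (x \<in> cube 0 j) * (1 / 2 ^ (CARD('d) - 2)) ^ j)"
proof -
  define \<rho> :: real where "\<rho> = 1 / 2 ^ (CARD('d) - 2)"
  \<comment> \<open>The term of the least scale suffices: \<open>x\<close> is outside the cube of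
    scale \<open>j - 1\<close>, so the decay loses one factor \<open>1 / \<rho>\<close>; for
    \<open>j = 0\<close> the uniform bound \<open>C\<close> is used.\<close>
  define j where "j = (LEAST j. x \<in> cube 0 j)"
  have j: "x \<in> cube 0 j" "j \<le> J"
    using assms unfolding j_def by (auto intro: LeastI Least_le)
  have "G x \<le> C / \<rho> * \<rho> ^ j"
  proof (cases j)
    case 0
    have "C \<le> C / \<rho>" using C_pos by (simp add: \<rho>_def)
    then show ?thesis using 0 G_le[of x] by simp
  next
    case (Suc i)
    then have "x \<notin> cube 0 i" using not_less_Least[of i "\<lambda>j. x \<in> cube 0 j"] by (auto simp: j_def)
    then show ?thesis using G_decay[of x i] Suc by (simp add: \<rho>_def)
  qed
  also have "\<dots> \<le> C / \<rho> * (\<Sum>j\<le>J. of_bool (x \<in> cube 0 j) * \<rho> ^ j)"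
  proof (rule mult_left_mono)
    have "\<rho> ^ j = of_bool (x \<in> cube 0 j) * \<rho> ^ j" using j by simp
    also have "\<dots> \<le> (\<Sum>j\<le>J. of_bool (x \<in> cube 0 j) * \<rho> ^ j)"
      using j by (intro member_le_sum) (auto simp: \<rho>_def)
    finally show "\<rho> ^ j \<le> (\<Sum>j\<le>J. of_bool (x \<in> cube 0 j) * \<rho> ^ j)" .
  qed (use C_pos in \<open>simp add: \<rho>_def\<close>)
  finally show ?thesis by (simp add: \<rho>_def)
qed

lemma sum_G_le_dyadic:
  assumes "finite Y" "Y \<subseteq> cube z J" "\<And>y. y \<in> Y \<Longrightarrow> f y \<ge> 0"
  shows "(\<Sum>y\<in>Y. G (z - y) * f y) \<le>
    C * 2 ^ (CARD('d) - 2) * (\<Sum>j\<le>J. (1 / 2 ^ (CARD('d) - 2)) ^ j * (\<Sum>y\<in>Y \<inter> cube z j. f y))"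
proof -
  define \<rho> :: real where "\<rho> = 1 / 2 ^ (CARD('d) - 2)"
  have cube_diff: "z - y \<in> cube 0 j \<longleftrightarrow> y \<in> cube z j" for y j
    by (simp add: cube_def abs_minus_commute)
  have "(\<Sum>y\<in>Y. G (z - y) * f y) \<le>
      (\<Sum>y\<in>Y. C * 2 ^ (CARD('d) - 2) * (\<Sum>j\<le>J. of_bool (y \<in> cube z j) * \<rho> ^ j) * f y)"
    using assms G_le_dyadic[of "z - y" J for y]
    by (intro sum_mono mult_right_mono) (auto simp: cube_diff \<rho>_def)
  also have "\<dots> = C * 2 ^ (CARD('d) - 2) * (\<Sum>y\<in>Y. \<Sum>j\<le>J. \<rho> ^ j * (of_bool (y \<in> cube z j) * f y))"
    by (simp add: sum_distrib_left sum_distrib_right mult_ac del: sum_mult_of_bool_eq sum_of_bool_mult_eq)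
  also have "(\<Sum>y\<in>Y. \<Sum>j\<le>J. \<rho> ^ j * (of_bool (y \<in> cube z j) * f y))
      = (\<Sum>j\<le>J. \<rho> ^ j * (\<Sum>y\<in>Y \<inter> cube z j. f y))"
    using assms(1)
    by (subst sum.swap) (auto simp: sum_distrib_left[symmetric] sum.inter_restrict intro!: sum.cong)
  finally show ?thesis by (simp add: \<rho>_def)
qed

text \<open>The factor 2^(2 - d) * 2^d = 4 per scale is diffusive scaling: the walk spends a time of
  order r^2 in a cube of side r.\<close>

lemma decay_times_volume: "(1 / 2 ^ (CARD('d) - 2)) ^ j * (2 ^ CARD('d)) ^ j = (4::real) ^ j"
proof -
  have "CARD('d) = CARD('d) - 2 + 2" using dim by simp
  then have "(2::real) ^ CARD('d) = 2 ^ (CARD('d) - 2 + 2)" by (rule arg_cong)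
  also have "\<dots> = 2 ^ (CARD('d) - 2) * 4" unfolding power_add by simp
  finally have "1 / 2 ^ (CARD('d) - 2) * 2 ^ CARD('d) = (4::real)" by simp
  then show ?thesis by (simp only: power_mult_distrib[symmetric])
qed

text \<open>The bound is uniform in the starting point \<open>z\<close>: the part of the cube near
  \<open>z\<close> is summed over dyadic scales about \<open>z\<close>, the rest is estimated by
  decay times volume.\<close>

lemma sum_G_cube_le:
  obtains K where "K > 0" "\<And>w z i. (\<Sum>y\<in>cube w i. G (z - y)) \<le> K * 4 ^ i"
proof -
  define \<rho> :: real where "\<rho> = 1 / 2 ^ (CARD('d) - 2)"
  define V :: real where "V = 2 ^ CARD('d)"
  define B where "B = C * 2 ^ (CARD('d) - 2)"
  have B: "B > 0" using C_pos by (simp add: B_def)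
  have V: "V > 0" by (simp add: V_def)
  have r0: "\<rho> \<ge> 0" by (simp add: \<rho>_def)
  have rV: "\<rho> ^ j * V ^ j = 4 ^ j" for j unfolding \<rho>_def V_def by (rule decay_times_volume)
  have card_V: "real (card S) \<le> V * V ^ i" if "S \<subseteq> cube w i" for S i and w :: "int ^ 'd"
  proof -
    have "card S \<le> card (cube w i)" using that by (intro card_mono finite_cube)
    also note card_cube
    finally have "real (card S) \<le> real (2 ^ CARD('d) * (2 ^ CARD('d)) ^ i)"
      by (subst of_nat_le_iff)
    then show ?thesis by (simp add: V_def)
  qed
  show ?thesis
  proof (rule that[of "B * (V * 2) + C * V"])
    fix w z :: "int ^ 'd" and i
    have "(\<Sum>y\<in>cube w i \<inter> cube z i. G (z - y) * 1)
        \<le> B * (\<Sum>j\<le>i. \<rho> ^ j * (\<Sum>y\<in>cube w i \<inter> cube z i \<inter> cube z j. 1))"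
      unfolding B_def \<rho>_def by (intro sum_G_le_dyadic) (auto simp: finite_cube)
    also have "\<dots> \<le> B * (\<Sum>j\<le>i. \<rho> ^ j * (V * V ^ j))"
      using B r0 by (intro mult_left_mono sum_mono) (auto intro!: card_V[of _ z])
    also have "(\<Sum>j\<le>i. \<rho> ^ j * (V * V ^ j)) = V * (\<Sum>j\<le>i. 4 ^ j)"
      by (simp add: sum_distrib_left rV[symmetric] mult_ac)
    also have "(\<Sum>j\<le>i. (4::real) ^ j) \<le> 2 * 4 ^ i"
    proof (induction i)
      case (Suc i)
      have "(4::real) ^ i \<ge> 0" by simp
      then show ?case using Suc by (simp del: zero_le_power) 
    qed simp
    finally have 1: "(\<Sum>y\<in>cube w i \<inter> cube z i. G (z - y)) \<le> B * (V * (2 * 4 ^ i))"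
      using B V by simp
    have "(\<Sum>y\<in>cube w i - cube z i. G (z - y)) \<le> (\<Sum>y\<in>cube w i - cube z i. C * \<rho> ^ i)"
    proof (rule sum_mono)
      fix y assume "y \<in> cube w i - cube z i"
      then have "z - y \<notin> cube 0 i" by (auto simp: cube_def abs_minus_commute)
      then show "G (z - y) \<le> C * \<rho> ^ i" unfolding \<rho>_def by (rule G_decay)
    qed
    also have "\<dots> \<le> V * V ^ i * (C * \<rho> ^ i)"
      unfolding sum_constant using C_pos r0 by (intro mult_right_mono card_V[of _ w]) auto
    also have "\<dots> = C * V * 4 ^ i" by (simp add: rV[symmetric])
    finally have 2: "(\<Sum>y\<in>cube w i - cube z i. G (z - y)) \<le> C * V * 4 ^ i" .
    have "(\<Sum>y\<in>cube w i. G (z - y))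
        = (\<Sum>y\<in>cube w i \<inter> cube z i. G (z - y)) + (\<Sum>y\<in>cube w i - cube z i. G (z - y))"
      by (rule sum.Int_Diff) (rule finite_cube)
    with 1 2 show "(\<Sum>y\<in>cube w i. G (z - y)) \<le> (B * (V * 2) + C * V) * 4 ^ i"
      by (simp add: algebra_simps)
  qed (use B V C_pos in \<open>auto intro!: add_pos_pos\<close>)
qed

end

section \<open>Occupation of cubes and potentials of local times\<close>

lemma path_sum_cong:
  assumes "stays Y xs" "\<And>ys. sum_list ys \<in> Y \<Longrightarrow> f ys = g ys"
  shows "path_sum f xs = path_sum g xs"
  using assms(1) by (induction xs) (auto simp: stays.simps assms(2))

text \<open>The visit that raises the local time of \<open>y\<close> to \<open>j\<close> contributes
  \<open>f j\<close>, so the sum over time can be rearranged by sites.\<close>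

lemma path_sum_loc:
  assumes "finite Y"
  shows "path_sum (\<lambda>xs. if sum_list xs \<in> Y then f (loc xs (sum_list xs)) else 0) xs
    = (\<Sum>y\<in>Y. \<Sum>j=1..loc xs y. f j)"
proof (induction xs)
  case Nil
  have "(\<Sum>y\<in>Y. \<Sum>j=1..loc [] y. f j) = (\<Sum>y\<in>Y. if y = 0 then f 1 else 0)"
    by (intro sum.cong) auto
  then show ?case using assms by simp
next
  case (Cons s xs)
  let ?z = "sum_list (s # xs)"
  have "(\<Sum>y\<in>Y. \<Sum>j=1..loc (s # xs) y. f j)
      = (\<Sum>y\<in>Y. (\<Sum>j=1..loc xs y. f j) + (if y = ?z then f (loc (s # xs) ?z) else 0))"
    by (intro sum.cong) (auto simp: loc.simps)
  also have "\<dots> = (\<Sum>y\<in>Y. \<Sum>j=1..loc xs y. f j) + (if ?z \<in> Y then f (loc (s # xs) ?z) else 0)"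
    using assms by (simp add: sum.distrib)
  finally show ?case using Cons by simp
qed

text \<open>A finite window that holds every path of at most \<open>n\<close> steps; sums over the
  lattice and unions over cube centres are restricted to it at polynomial cost.\<close>

definition box :: "nat \<Rightarrow> (int ^ 'd) set" where
  "box n = {x. \<forall>k. \<bar>x $ k\<bar> < int (Suc n)}"

lemma finite_box: "finite (box n :: (int ^ 'd) set)"
  and card_box: "card (box n :: (int ^ 'd) set) \<le> (2 * Suc n) ^ CARD('d)"
  using card_cube_le[of "Suc n" "0 :: int ^ 'd"] by (simp_all add: box_def)

lemma stays_box:
  assumes "xs \<in> step_lists m" "m \<le> n"
  shows "stays (box n) xs"
proof -
  have small: "\<bar>sum_list xs $ k\<bar> \<le> int (length xs)"
    if "set xs \<subseteq> unit_steps" for xs :: "(int ^ 'd) list" and k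
    using that
  proof (induction xs)
    case (Cons s xs)
    then have "\<bar>s $ k\<bar> \<le> 1" by (auto simp: unit_steps_def axis_def)
    then show ?case using Cons by (simp add: abs_le_iff)
  qed simp
  have "set xs \<subseteq> unit_steps" "length xs \<le> n" using assms by (auto simp: step_lists_def)
  then show ?thesis
  proof (induction xs)
    case Nil
    then show ?case by (simp add: box_def)
  next
    case (Cons s xs)
    have "\<bar>sum_list (s # xs) $ k\<bar> < int (Suc n)" for k
      using small[OF Cons.prems(1), of k] Cons.prems(2) by linarith
    then show ?case using Cons by (auto simp: stays.simps box_def)
  qed
qed

lemma stays_loc_pos: "stays Y xs \<Longrightarrow> {x. loc xs x > 0} \<subseteq> Y"
  by (induction xs) (auto simp: loc.simps stays.simps)

text \<open>The difference is of lower order than \<open>j powr a\<close>; the finitely many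
  exceptional \<open>j\<close> go into \<open>K\<close>. This is what makes the growth of the weight
  at a visit affordable.\<close>

lemma powr_backward_diff_le:
  fixes a \<epsilon> :: real
  assumes "a > 0" "\<epsilon> > 0"
  obtains K where "K \<ge> 0" "\<And>j::nat. j \<ge> 1 \<Longrightarrow> real j powr a - real (j - 1) powr a \<le> \<epsilon> * real j powr a + K"
proof -
  have "(\<lambda>j::nat. (real j - 1) powr a / real j powr a) \<longlonglongrightarrow> 1"
    using assms by real_asymp
  then have "eventually (\<lambda>j::nat. (real j - 1) powr a / real j powr a > 1 - \<epsilon>) sequentially"
    using assms by (intro order_tendstoD) auto
  then obtain N where N: "\<And>j. j \<ge> N \<Longrightarrow> (real j - 1) powr a / real j powr a > 1 - \<epsilon>"
    by (auto simp: eventually_sequentially)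
  show ?thesis
  proof (rule that[of "real N powr a"])
    fix j :: nat assume j: "j \<ge> 1"
    show "real j powr a - real (j - 1) powr a \<le> \<epsilon> * real j powr a + real N powr a"
    proof (cases "j \<ge> N")
      case True
      then have "(1 - \<epsilon>) * real j powr a < (real j - 1) powr a"
        using N[OF True] j by (simp add: field_simps)
      moreover have "real N powr a \<ge> 0" by simp
      moreover have "real (j - 1) powr a = (real j - 1) powr a" using j by (simp add: of_nat_diff)
      ultimately show ?thesis unfolding left_diff_distrib by linarith
    next
      case False
      then have "real j powr a \<le> real N powr a" using assms by (intro powr_mono2) auto
      moreover have "\<epsilon> * real j powr a \<ge> 0" "real (j - 1) powr a \<ge> 0" using assms by auto
      ultimately show ?thesis by linarith
    qed
  qed auto
qed

text \<open>The sum dominates the integral of \<open>t powr (p - 1)\<close> from 0 to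
  \<open>l\<close>; each step is the tangent inequality at \<open>Suc l\<close>.\<close>

lemma powr_le_sum:
  fixes p :: real
  assumes "p > 1"
  shows "real l powr p / p \<le> (\<Sum>j=1..l. real j powr (p - 1))"
proof (induction l)
  case (Suc l)
  have e: "real (Suc l) powr p = real (Suc l) powr (p - 1) * real (Suc l)"
    by (simp add: powr_diff)
  have "p * real (Suc l) powr (p - 1) * real l \<le> real l powr p + (p - 1) * real (Suc l) powr p"
    using assms by (intro powr_tangent) auto
  then have "real (Suc l) powr p \<le> real l powr p + p * real (Suc l) powr (p - 1)"
    unfolding e by (simp add: algebra_simps)
  then have "real (Suc l) powr p / p \<le> (real l powr p + p * real (Suc l) powr (p - 1)) / p"
    using assms by (intro divide_right_mono) auto
  then show ?case using Suc assms by (simp add: add_divide_distrib)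
qed (use assms in simp)

context green_majorant
begin

text \<open>The weight is constantly 1 on the cube: it does not grow (\<open>D = 0\<close>), and its
  potential is at most \<open>L = K * 4 ^ i\<close> everywhere, so \<open>good\<close> can be
  trivial. Markov's inequality turns the exponential moment into a tail.\<close>

lemma avg_cube_occupation_le:
  obtains c where "c > 0"
    "\<And>n (w :: int ^ 'd) i u. avg n (\<lambda>xs. of_bool (u * 4 ^ i < (\<Sum>y\<in>cube w i. real (loc xs y)))) \<le> 4 * exp (- c * u)"
proof -
  obtain K where K: "K > 0" "\<And>w z i. (\<Sum>y\<in>cube w i. G (z - y)) \<le> K * 4 ^ i"
    using sum_G_cube_le by metis
  show ?thesis
  proof (rule that[of "1 / (2 * K)"])
    fix n i u and w :: "int ^ 'd"
    define L where "L = K * 4 ^ i"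
    have L: "L > 0" using K by (simp add: L_def)
    define f where "f xs = (if sum_list xs \<in> cube w i then 1 :: real else 0)" for xs
    have le: "avg n (\<lambda>xs. of_bool True * exp (path_sum (\<lambda>xs. f xs / 2 - G 0 * 0) xs / L)) \<le> 4"
      unfolding f_def
      by (rule avg_exp_path_sum_le[where F = "\<lambda>_ _. 1" and D = "\<lambda>_. 0" and good = "\<lambda>_. True"])
        (use K L in \<open>auto simp: finite_cube L_def\<close>)
    have occ: "path_sum (\<lambda>xs. f xs / 2 - G 0 * 0) xs = (\<Sum>y\<in>cube w i. real (loc xs y)) / 2" for xs
    proof -
      have "path_sum (\<lambda>xs. f xs / 2 - G 0 * 0) xs = path_sum f xs / 2"
        by (induction xs) (auto simp: add_divide_distrib)
      also have "path_sum f xs = (\<Sum>y\<in>cube w i. \<Sum>j=1..loc xs y. 1)"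
        unfolding f_def by (subst path_sum_loc[OF finite_cube, symmetric]) simp
      finally show ?thesis by simp
    qed
    have 1: "avg n (\<lambda>xs. exp ((\<Sum>y\<in>cube w i. real (loc xs y)) / 2 / L)) \<le> 4"
      using le unfolding occ by simp
    have "avg n (\<lambda>xs. of_bool (u * 4 ^ i < (\<Sum>y\<in>cube w i. real (loc xs y)))) \<le>
       avg n (\<lambda>xs. exp (- (1 / (2 * K)) * u) * exp ((\<Sum>y\<in>cube w i. real (loc xs y)) / 2 / L))"
    proof (rule avg_mono)
      fix xs
      let ?S = "\<Sum>y\<in>cube w i. real (loc xs y)"
      show "of_bool (u * 4 ^ i < ?S) \<le> exp (- (1 / (2 * K)) * u) * exp (?S / 2 / L)"
      proof (cases "u * 4 ^ i < ?S")
        case True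
        then have "u / (2 * K) \<le> ?S / 2 / L"
          using K(1) by (simp add: L_def field_simps)
        then have "1 \<le> exp (- (1 / (2 * K)) * u + ?S / 2 / L)" by simp
        then show ?thesis unfolding exp_add by simp
      qed simp
    qed
    also have "\<dots> \<le> exp (- (1 / (2 * K)) * u) * 4"
      unfolding avg_cmult using 1 by (intro mult_left_mono) auto
    finally show "avg n (\<lambda>xs. of_bool (u * 4 ^ i < (\<Sum>y\<in>cube w i. real (loc xs y))))
        \<le> 4 * exp (- (1 / (2 * K)) * u)" by simp
  qed (use K in auto)
qed

text \<open>
  Below the exponent 1, \<open>l powr q\<close> is summed over a cube of side \<open>2 ^ j\<close> by concavity, with \<open>m\<close> the
  average occupation there; the condition on \<open>q\<close> makes the contributions of the scales geometric.
\<close>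

lemma sum_G_powr_le_1:
  fixes q :: real
  assumes q: "q > 2 / (real CARD('d) - 2)" "q \<le> 1"
  shows "\<exists>K>0. \<forall>Y l u z. finite Y \<longrightarrow> u > 0 \<longrightarrow> (\<forall>y\<in>Y. l y \<ge> 0) \<longrightarrow>
      (\<forall>z\<in>Y. \<forall>j. (\<Sum>y\<in>Y \<inter> cube z j. l y) \<le> u * 4 ^ j) \<longrightarrow> z \<in> Y \<longrightarrow>
      (\<Sum>y\<in>Y. G (z - y) * l y powr q) \<le> K * u powr q"
proof -
  define \<rho> :: real where "\<rho> = 1 / 2 ^ (CARD('d) - 2)"
  define V :: real where "V = 2 ^ CARD('d)"
  define B where "B = C * 2 ^ (CARD('d) - 2)"
  \<comment> \<open>The ratio of the bounds at consecutive scales: it equals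
    \<open>2 powr (2 - (d - 2) * q)\<close>, which is below 1 exactly for
    \<open>q > 2 / (d - 2)\<close>.\<close>
  define r where "r = 4 * (4 / V) powr q"
  have d: "real CARD('d) \<ge> 3" using dim by simp
  have "2 / (real CARD('d) - 2) > 0" using d by simp
  then have q0: "q > 0" using q(1) by linarith
  have V: "V > 0" by (simp add: V_def)
  have V': "V = 2 powr real CARD('d)" by (simp add: V_def powr_realpow)
  have B: "B > 0" using C_pos by (simp add: B_def)
  have rho: "\<rho> > 0" by (simp add: \<rho>_def)
  have rV: "\<rho> ^ j * V ^ j = 4 ^ j" for j unfolding \<rho>_def V_def by (rule decay_times_volume)
  have "(4::real) = 2 powr 2" by simp
  then have "r = 2 powr (2 - (real CARD('d) - 2) * q)"
    unfolding r_def V' by (simp only: powr_powr powr_add[symmetric] powr_diff[symmetric])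
      (simp add: algebra_simps)
  moreover have "2 - (real CARD('d) - 2) * q < 0" using q(1) d by (simp add: field_simps)
  ultimately have r1: "r < 1" using powr_less_mono[of "2 - (real CARD('d) - 2) * q" 0 2] by simp
  have r0: "r > 0" using V by (simp add: r_def)
  show ?thesis
  proof (intro exI[of _ "B * (2 * V) / (1 - r)"] conjI allI impI)
    fix Y u and l :: "int ^ 'd \<Rightarrow> real" and z :: "int ^ 'd"
    assume Y: "finite Y" and u: "u > 0" and l': "\<forall>y\<in>Y. l y \<ge> 0"
      and occ': "\<forall>z\<in>Y. \<forall>j. (\<Sum>y\<in>Y \<inter> cube z j. l y) \<le> u * 4 ^ j" and z: "z \<in> Y"
    have l: "l y \<ge> 0" if "y \<in> Y" for y using l' that by blast
    have occ: "(\<Sum>y\<in>Y \<inter> cube z j. l y) \<le> u * 4 ^ j" if "z \<in> Y" for z j using occ' that by blast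
    obtain J where J: "Y \<subseteq> cube z J"
    proof -
      have "\<exists>j. y \<in> cube z j" for y
      proof -
        define M where "M = Max (range (\<lambda>k. nat \<bar>y $ k - z $ k\<bar>))"
        have "\<bar>y $ k - z $ k\<bar> < 2 ^ M" for k
        proof -
          have "nat \<bar>y $ k - z $ k\<bar> \<le> M" unfolding M_def by (intro Max_ge) auto
          also have "M < 2 ^ M" by (rule less_exp)
          finally show ?thesis by (simp add: nat_less_iff)
        qed
        then show ?thesis by (auto simp: cube_def)
      qed
      then obtain j where j: "\<And>y. y \<in> cube z (j y)" by metis
      have "Y \<subseteq> cube z (Max (j ` Y))"
      proof
        fix y assume "y \<in> Y"
        then have "j y \<le> Max (j ` Y)" using Y by auto
        then show "y \<in> cube z (Max (j ` Y))" using j[of y] cube_mono by blast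
      qed
      then show ?thesis by (rule that)
    qed
    have scale: "\<rho> ^ j * (\<Sum>y\<in>Y \<inter> cube z j. l y powr q) \<le> 2 * V * u powr q * r ^ j" for j
    proof -
      define m where "m = u * 4 ^ j / V ^ j"
      have m: "m > 0" using u V by (simp add: m_def)
      \<comment> \<open>The first term covers values up to \<open>m\<close>, the second, as
        \<open>q \<le> 1\<close>, the larger ones. With \<open>m\<close> the average occupation,
        both sum to order \<open>V ^ j * m powr q\<close>.\<close>
      have pt: "l y powr q \<le> m powr q + m powr (q - 1) * l y" if "y \<in> Y" for y
      proof (cases "l y \<le> m")
        case True
        then have "l y powr q \<le> m powr q" using l that q0 by (intro powr_mono2) auto
        moreover have "m powr (q - 1) * l y \<ge> 0" using l that by auto
        ultimately show ?thesis by linarith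
      next
        case False
        then have "l y powr (q - 1) \<le> m powr (q - 1)" using m q by (intro powr_mono2') auto
        then have "l y powr (q - 1) * l y \<le> m powr (q - 1) * l y" using l that by (intro mult_right_mono) auto
        moreover have "l y powr q = l y powr (q - 1) * l y" using False m by (simp add: powr_diff)
        moreover have "m powr q \<ge> 0" by simp
        ultimately show ?thesis by linarith
      qed
      have "real (card (Y \<inter> cube z j)) \<le> V * V ^ j"
      proof -
        have "card (Y \<inter> cube z j) \<le> card (cube z j)" by (intro card_mono finite_cube) auto
        also note card_cube
        finally have "real (card (Y \<inter> cube z j)) \<le> real (2 ^ CARD('d) * (2 ^ CARD('d)) ^ j)"
          by (subst of_nat_le_iff)
        then show ?thesis by (simp add: V_def)
      qed
      then have c: "card (Y \<inter> cube z j) * m powr q \<le> V * V ^ j * m powr q"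
        by (intro mult_right_mono) auto
      have V1: "V \<ge> 1" by (simp add: V_def)
      have "(\<Sum>y\<in>Y \<inter> cube z j. l y powr q) \<le> (\<Sum>y\<in>Y \<inter> cube z j. m powr q + m powr (q - 1) * l y)"
        by (intro sum_mono pt) auto
      also have "\<dots> = card (Y \<inter> cube z j) * m powr q + m powr (q - 1) * (\<Sum>y\<in>Y \<inter> cube z j. l y)"
        by (simp add: sum.distrib sum_distrib_left)
      also have "\<dots> \<le> V * V ^ j * m powr q + m powr (q - 1) * (u * 4 ^ j)"
        by (intro add_mono c mult_left_mono occ z) auto
      also have "u * 4 ^ j = V ^ j * m" using V by (simp add: m_def)
      also have "m powr (q - 1) * (V ^ j * m) = V ^ j * m powr q"
        using m by (simp add: powr_diff)
      also have "V * V ^ j * m powr q + V ^ j * m powr q \<le> 2 * V * V ^ j * m powr q"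
        using V1 V mult_right_mono[of 1 V "V ^ j * m powr q"] by simp
      finally have "\<rho> ^ j * (\<Sum>y\<in>Y \<inter> cube z j. l y powr q) \<le> \<rho> ^ j * (2 * V * V ^ j * m powr q)"
        using rho by (intro mult_left_mono) auto
      also have "\<dots> = 2 * V * ((\<rho> ^ j * V ^ j) * m powr q)" by simp
      also have "(\<rho> ^ j * V ^ j) * m powr q = u powr q * r ^ j"
      proof -
        have "m = u * (4 / V) ^ j" by (simp add: m_def power_divide)
        moreover have "((4 / V) ^ j) powr q = ((4 / V) powr q) ^ j"
          using V by (simp add: powr_powr mult.commute flip: powr_realpow)
        ultimately show ?thesis
          using V u by (simp add: rV r_def powr_mult power_mult_distrib)
      qed
      finally show ?thesis by simp
    qed
    have "(\<Sum>y\<in>Y. G (z - y) * l y powr q) \<le> B * (\<Sum>j\<le>J. \<rho> ^ j * (\<Sum>y\<in>Y \<inter> cube z j. l y powr q))"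
      unfolding B_def \<rho>_def by (intro sum_G_le_dyadic) (auto simp: Y J)
    also have "\<dots> \<le> B * (\<Sum>j\<le>J. 2 * V * u powr q * r ^ j)"
      using B by (intro mult_left_mono sum_mono scale) auto
    also have "\<dots> = B * (2 * V * u powr q) * (\<Sum>j\<le>J. r ^ j)"
      by (simp add: sum_distrib_left mult_ac)
    also have "\<dots> \<le> B * (2 * V * u powr q) * (1 / (1 - r))"
    proof (rule mult_left_mono)
      have "(\<Sum>j\<le>J. r ^ j) = (1 - r ^ Suc J) / (1 - r)"
        using r1 by (simp add: sum_gp0)
      also have "\<dots> \<le> 1 / (1 - r)" using r0 r1 by (intro divide_right_mono) auto
      finally show "(\<Sum>j\<le>J. r ^ j) \<le> 1 / (1 - r)" .
    qed (use B V in auto)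
    finally show "(\<Sum>y\<in>Y. G (z - y) * l y powr q) \<le> B * (2 * V) / (1 - r) * u powr q"
      by (simp add: mult_ac)
  qed (use B V r1 in auto)
qed

text \<open>For \<open>q > 1\<close> the occupation bound at scale 0 gives
  \<open>l y \<le> u\<close>, hence \<open>l powr q \<le> u powr (q - 1) * l\<close>, which reduces
  to the exponent 1. That exponent exceeds \<open>2 / (d - 2)\<close> because
  \<open>d \<ge> 5\<close>.\<close>

lemma sum_G_powr_le:
  fixes q :: real
  assumes q: "q > 2 / (real CARD('d) - 2)" and d5: "CARD('d) \<ge> 5"
  shows "\<exists>K>0. \<forall>Y l u z. finite Y \<longrightarrow> u > 0 \<longrightarrow> (\<forall>y\<in>Y. l y \<ge> 0) \<longrightarrow>
      (\<forall>z\<in>Y. \<forall>j. (\<Sum>y\<in>Y \<inter> cube z j. l y) \<le> u * 4 ^ j) \<longrightarrow> z \<in> Y \<longrightarrow>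
      (\<Sum>y\<in>Y. G (z - y) * l y powr q) \<le> K * u powr q"
proof (cases "q \<le> 1")
  case True
  show ?thesis by (rule sum_G_powr_le_1[OF q True])
next
  case False
  have "1 > 2 / (real CARD('d) - 2)" using d5 by simp
  then obtain K where K: "K > 0" and K_le: "\<forall>Y l u z. finite Y \<longrightarrow> u > 0 \<longrightarrow> (\<forall>y\<in>Y. l y \<ge> 0) \<longrightarrow>
      (\<forall>z\<in>Y. \<forall>j. (\<Sum>y\<in>Y \<inter> cube z j. l y) \<le> u * 4 ^ j) \<longrightarrow> z \<in> Y \<longrightarrow>
      (\<Sum>y\<in>Y. G (z - y) * l y powr 1) \<le> K * u powr 1"
    using sum_G_powr_le_1[OF _ order_refl] by blast
  show ?thesis
  proof (intro exI[of _ K] conjI allI impI K)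
    fix Y u and l :: "int ^ 'd \<Rightarrow> real" and z :: "int ^ 'd"
    assume Y: "finite Y" and u: "u > 0" and l: "\<forall>y\<in>Y. l y \<ge> 0"
      and occ: "\<forall>z\<in>Y. \<forall>j. (\<Sum>y\<in>Y \<inter> cube z j. l y) \<le> u * 4 ^ j" and z: "z \<in> Y"
    have pt: "l y powr q \<le> u powr (q - 1) * l y powr 1" if "y \<in> Y" for y
    proof -
      have "l y \<le> u" using occ[rule_format, OF that, of 0] that by (simp add: cube_0)
      then have "l y powr (q - 1) \<le> u powr (q - 1)" using l that False by (intro powr_mono2) auto
      then have "l y powr (q - 1) * l y powr 1 \<le> u powr (q - 1) * l y powr 1"
        by (intro mult_right_mono) auto
      moreover have "l y powr (q - 1) * l y powr 1 = l y powr q" by (simp only: powr_add[symmetric]) simp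
      ultimately show ?thesis by simp
    qed
    have "(\<Sum>y\<in>Y. G (z - y) * l y powr q) \<le> (\<Sum>y\<in>Y. G (z - y) * (u powr (q - 1) * l y powr 1))"
      by (intro sum_mono mult_left_mono pt G_nonneg)
    also have "\<dots> = u powr (q - 1) * (\<Sum>y\<in>Y. G (z - y) * l y powr 1)"
      by (simp add: sum_distrib_left mult_ac)
    also have "\<dots> \<le> u powr (q - 1) * (K * u powr 1)"
      using K_le Y u l occ z by (intro mult_left_mono) auto
    also have "\<dots> = K * u powr q" using u by (simp add: powr_diff)
    finally show "(\<Sum>y\<in>Y. G (z - y) * l y powr q) \<le> K * u powr q" .
  qed
qed

end

section \<open>The tail estimate with free parameters\<close>

context green_majorant
begin

text \<open>
  The weight \<open>\<phi> = max 0 (j powr (p - 1) - s)\<close> of a site visited \<open>j\<close> times discards the sites of low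
  local time, whose potential would be too large, but still sums up to almost \<open>l powr p / p\<close>.
\<close>

lemma prob_sum_local_time_powr_le:
  fixes p q :: real
  assumes d5: "CARD('d) \<ge> 5" and p: "p > 1" and q: "q > 2 / (real CARD('d) - 2)"
  shows "\<exists>c>0. \<exists>K>0. \<forall>n u A s B. u \<ge> 1 \<longrightarrow> s \<ge> 0 \<longrightarrow> B > 0 \<longrightarrow>
      (\<forall>j::nat. real j powr (p - 1) - s \<le> B * real j powr q) \<longrightarrow>
      \<P>(\<omega> in srw_steps. (\<Sum>\<^sub>\<infinity>x::int^'d. real (local_time (walk \<omega>) n x) powr p) > A)
        \<le> 4 * exp (- (A / (4 * p) - (s / 2 + K) * (real n + 1)) / (K * B * u powr q))
          + (2 * real n + 2) ^ CARD('d) * real n * (4 * exp (- c * u))"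
proof -
  obtain c where c: "c > 0" and occ: "\<And>n (w :: int ^ 'd) i u.
      avg n (\<lambda>xs. of_bool (u * 4 ^ i < (\<Sum>y\<in>cube w i. real (loc xs y)))) \<le> 4 * exp (- c * u)"
    using avg_cube_occupation_le by metis
  obtain K1 where K1: "K1 > 0" and pot: "\<forall>Y l u z. finite Y \<longrightarrow> u > 0 \<longrightarrow> (\<forall>y\<in>Y. l y \<ge> 0) \<longrightarrow>
      (\<forall>z\<in>Y. \<forall>j. (\<Sum>y\<in>Y \<inter> cube z j. l y) \<le> u * 4 ^ j) \<longrightarrow> z \<in> Y \<longrightarrow>
      (\<Sum>y\<in>Y. G (z - y) * l y powr q) \<le> K1 * u powr q"
    using sum_G_powr_le[OF q d5] by blast
  have G0: "G 0 \<ge> 1" by (rule G0_ge_1)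
  \<comment> \<open>With \<open>1 / (4 * G 0)\<close> the growth cost takes only a quarter of
    \<open>j powr (p - 1)\<close> out of the half that the exponential bound provides.\<close>
  obtain K2 where K2: "K2 \<ge> 0" "\<And>j::nat. j \<ge> 1 \<Longrightarrow>
      real j powr (p - 1) - real (j - 1) powr (p - 1) \<le> 1 / (4 * G 0) * real j powr (p - 1) + K2"
    using powr_backward_diff_le[of "p - 1" "1 / (4 * G 0)"] p G0 by auto
  define K where "K = max K1 (G 0 * K2)"
  have K: "K > 0" "K \<ge> K1" "K \<ge> G 0 * K2" using K1 by (auto simp: K_def)
  show ?thesis
  proof (rule exI[of _ c], intro conjI c, rule exI[of _ K], intro conjI allI impI K(1))
    fix n :: nat and u A s B :: real
    assume u: "u \<ge> 1" and s: "s \<ge> 0" and B: "B > 0"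
      and phi_le': "\<forall>j::nat. real j powr (p - 1) - s \<le> B * real j powr q"
    define \<phi> where "\<phi> j = max 0 (real j powr (p - 1) - s)" for j :: nat
    define L where "L = K * B * u powr q"
    have L: "L > 0" using K B u by (simp add: L_def)
    have phi0: "\<phi> 0 = 0" using s p by (simp add: \<phi>_def)
    have phi_nonneg: "\<phi> j \<ge> 0" for j by (simp add: \<phi>_def)
    have phi_le: "\<phi> j \<le> B * real j powr q" for j using phi_le' B by (simp add: \<phi>_def)
    have phi_mono: "\<phi> i \<le> \<phi> j" if "i \<le> j" for i j
    proof -
      have "real i powr (p - 1) \<le> real j powr (p - 1)" using that p by (intro powr_mono2) auto
      then show ?thesis unfolding \<phi>_def by (intro max.mono) auto
    qed
    \<comment> \<open>Contribution of the \<open>j\<close>-th visit to the exponent, growth cost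
      included. Its lower bound loses \<open>s / 2 + K\<close> per visit, which over
      \<open>n + 1\<close> visits gives the linear error term.\<close>
    define \<psi> where "\<psi> j = \<phi> j / 2 - G 0 * (\<phi> j - \<phi> (j - 1))" for j
    have psi: "\<psi> j \<ge> real j powr (p - 1) / 4 - (s / 2 + K)" if "j \<ge> 1" for j
    proof -
      have "real (j - 1) powr (p - 1) \<le> real j powr (p - 1)" using p by (intro powr_mono2) auto
      then have "\<phi> j - \<phi> (j - 1) \<le> real j powr (p - 1) - real (j - 1) powr (p - 1)"
        by (simp add: \<phi>_def max_def)
      also have "\<dots> \<le> 1 / (4 * G 0) * real j powr (p - 1) + K2" by (rule K2(2)[OF that])
      finally have "G 0 * (\<phi> j - \<phi> (j - 1)) \<le> G 0 * (1 / (4 * G 0) * real j powr (p - 1) + K2)"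
        using G0 by (intro mult_left_mono) auto
      also have "\<dots> = real j powr (p - 1) / 4 + G 0 * K2"
        using G0 by (simp add: distrib_left)
      finally have "G 0 * (\<phi> j - \<phi> (j - 1)) \<le> real j powr (p - 1) / 4 + K" using K by linarith
      moreover have "real j powr (p - 1) - s \<le> \<phi> j" by (simp add: \<phi>_def)
      ultimately show ?thesis by (simp add: \<psi>_def)
    qed
    have psi_sum: "(\<Sum>j=1..l. \<psi> j) \<ge> real l powr p / (4 * p) - (s / 2 + K) * l" for l
    proof -
      have "real l powr p / (4 * p) \<le> (\<Sum>j=1..l. real j powr (p - 1)) / 4"
        using powr_le_sum[OF p, of l] by simp
      then have "real l powr p / (4 * p) - (s / 2 + K) * l \<le> (\<Sum>j=1..l. real j powr (p - 1) / 4 - (s / 2 + K))"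
        by (simp add: sum_subtractf sum_divide_distrib mult.commute)
      also have "\<dots> \<le> (\<Sum>j=1..l. \<psi> j)" using psi by (intro sum_mono) auto
      finally show ?thesis .
    qed
    define Y where "Y = (box n :: (int ^ 'd) set)"
    have Y: "finite Y" by (simp add: Y_def finite_box)
    \<comment> \<open>Asking for the bound at every site of \<open>Y\<close>, not just at the
      current position, makes \<open>good\<close> pass to shorter paths, since \<open>\<phi>\<close>
      increases with the local times.\<close>
    define good where "good xs \<longleftrightarrow> stays Y xs \<and> (\<forall>z\<in>Y. (\<Sum>y\<in>Y. G (z - y) * \<phi> (loc xs y)) \<le> L)" for xs
    define big where "big xs \<longleftrightarrow> (\<Sum>\<^sub>\<infinity>x::int^'d. real (loc xs x) powr p) > A" for xs
    define X where "X = (A / (4 * p) - (s / 2 + K) * (real n + 1)) / L"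
    have "avg n (\<lambda>xs. of_bool (good xs) * exp (path_sum (\<lambda>xs.
      (if sum_list xs \<in> Y then \<phi> (loc xs (sum_list xs)) else 0) / 2
        - G 0 * (\<phi> (loc xs (sum_list xs)) - \<phi> (loc xs (sum_list xs) - 1))) xs / L)) \<le> 4"
    proof (rule avg_exp_path_sum_le[where F = "\<lambda>xs y. \<phi> (loc xs y)"
          and D = "\<lambda>xs. \<phi> (loc xs (sum_list xs)) - \<phi> (loc xs (sum_list xs) - 1)"])
      fix s' xs and y :: "int ^ 'd"
      show "\<phi> (loc (s' # xs) y) = \<phi> (loc xs y) + (if y = sum_list (s' # xs)
          then \<phi> (loc (s' # xs) (sum_list (s' # xs))) - \<phi> (loc (s' # xs) (sum_list (s' # xs)) - 1) else 0)"
        by (auto simp: loc.simps)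
      show "\<phi> (loc xs (sum_list xs)) - \<phi> (loc xs (sum_list xs) - 1) \<ge> 0"
        using phi_mono[of "loc xs (sum_list xs) - 1" "loc xs (sum_list xs)"] by simp
      show "(\<Sum>y\<in>Y. G (sum_list xs - y) * \<phi> (loc xs y)) \<le> L" if "good xs"
        using that stays_last[of Y xs] by (auto simp: good_def)
      show "good xs" if g: "good (s' # xs)"
      proof -
        have "(\<Sum>y\<in>Y. G (z - y) * \<phi> (loc xs y)) \<le> L" if "z \<in> Y" for z
        proof -
          have "(\<Sum>y\<in>Y. G (z - y) * \<phi> (loc xs y)) \<le> (\<Sum>y\<in>Y. G (z - y) * \<phi> (loc (s' # xs) y))"
            by (intro sum_mono mult_left_mono phi_mono G_nonneg) (simp add: loc.simps)
          also have "\<dots> \<le> L" using g that by (simp add: good_def)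
          finally show ?thesis .
        qed
        then show ?thesis using g by (simp add: good_def stays.simps)
      qed
    qed (use Y L phi_nonneg in auto)
    moreover have "path_sum (\<lambda>xs. (if sum_list xs \<in> Y then \<phi> (loc xs (sum_list xs)) else 0) / 2
        - G 0 * (\<phi> (loc xs (sum_list xs)) - \<phi> (loc xs (sum_list xs) - 1))) xs
        = (\<Sum>y\<in>Y. \<Sum>j=1..loc xs y. \<psi> j)" if "stays Y xs" for xs
      unfolding path_sum_loc[OF Y, symmetric]
      by (intro path_sum_cong[OF that]) (simp add: \<psi>_def)
    then have "of_bool (good xs) * exp (path_sum (\<lambda>xs.
      (if sum_list xs \<in> Y then \<phi> (loc xs (sum_list xs)) else 0) / 2
        - G 0 * (\<phi> (loc xs (sum_list xs)) - \<phi> (loc xs (sum_list xs) - 1))) xs / L)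
       = of_bool (good xs) * exp ((\<Sum>y\<in>Y. \<Sum>j=1..loc xs y. \<psi> j) / L)" for xs
      by (auto simp: good_def)
    ultimately have avg4: "avg n (\<lambda>xs. of_bool (good xs) * exp ((\<Sum>y\<in>Y. \<Sum>j=1..loc xs y. \<psi> j) / L)) \<le> 4"
      by (simp only:)
    have good_big: "of_bool (good xs \<and> big xs)
        \<le> exp (- X) * (of_bool (good xs) * exp ((\<Sum>y\<in>Y. \<Sum>j=1..loc xs y. \<psi> j) / L))"
      if xs: "xs \<in> step_lists n" for xs
    proof (cases "good xs \<and> big xs")
      case True
      then have st: "stays Y xs" by (simp add: good_def)
      have tot: "(\<Sum>y\<in>Y. real (loc xs y)) = real n + 1"
        using sum_loc_stays[OF Y st] xs by (simp add: step_lists_def flip: of_nat_sum)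
      have "A < (\<Sum>y\<in>Y. real (loc xs y) powr p)"
        using True infsum_loc_powr[OF Y stays_loc_pos[OF st], of p] by (simp add: big_def)
      then have "A / (4 * p) \<le> (\<Sum>y\<in>Y. real (loc xs y) powr p) / (4 * p)"
        using p by (intro divide_right_mono) auto
      then have "A / (4 * p) - (s / 2 + K) * (real n + 1) \<le>
          (\<Sum>y\<in>Y. real (loc xs y) powr p) / (4 * p) - (s / 2 + K) * (\<Sum>y\<in>Y. real (loc xs y))"
        unfolding tot by simp
      also have "\<dots> = (\<Sum>y\<in>Y. real (loc xs y) powr p / (4 * p) - (s / 2 + K) * loc xs y)"
        by (simp only: sum_divide_distrib sum_distrib_left sum_subtractf)
      also have "\<dots> \<le> (\<Sum>y\<in>Y. \<Sum>j=1..loc xs y. \<psi> j)"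
        by (intro sum_mono psi_sum)
      finally have "X \<le> (\<Sum>y\<in>Y. \<Sum>j=1..loc xs y. \<psi> j) / L"
        unfolding X_def using L by (intro divide_right_mono) auto
      then have "1 \<le> exp (- X + (\<Sum>y\<in>Y. \<Sum>j=1..loc xs y. \<psi> j) / L)" by simp
      then show ?thesis using True unfolding exp_add by simp
    next
      case False
      then have "of_bool (good xs \<and> big xs) = (0::real)" by simp
      also have "\<dots> \<le> exp (- X) * (of_bool (good xs) * exp ((\<Sum>y\<in>Y. \<Sum>j=1..loc xs y. \<psi> j) / L))"
        by (intro mult_nonneg_nonneg) auto
      finally show ?thesis .
    qed
    \<comment> \<open>Union bound over centres and scales. Scales below \<open>n\<close> suffice:
      from scale \<open>n\<close> on, the total time \<open>n + 1\<close> is at most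
      \<open>u * 4 ^ j\<close> anyway.\<close>
    have not_good: "of_bool (\<not> good xs)
        \<le> (\<Sum>w\<in>Y. \<Sum>i<n. of_bool (u * 4 ^ i < (\<Sum>y\<in>cube w i. real (loc xs y))) :: real)"
      (is "_ \<le> (\<Sum>w\<in>Y. \<Sum>i<n. of_bool (?bad w i))")
      if xs: "xs \<in> step_lists n" for xs
    proof (cases "\<exists>w\<in>Y. \<exists>i<n. ?bad w i")
      case True
      then obtain w i where wi: "w \<in> Y" "i < n" "?bad w i" by blast
      have "(1::real) = of_bool (?bad w i)" using wi by simp
      also have "\<dots> \<le> (\<Sum>i<n. of_bool (?bad w i))"
        using wi by (intro member_le_sum) auto
      also have "\<dots> \<le> (\<Sum>w\<in>Y. \<Sum>i<n. of_bool (?bad w i))"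
        by (rule member_le_sum[where f = "\<lambda>w. \<Sum>i<n. of_bool (?bad w i)"]) (use wi Y in \<open>auto intro!: sum_nonneg\<close>)
      finally have "(1::real) \<le> (\<Sum>w\<in>Y. \<Sum>i<n. of_bool (?bad w i))" .
      moreover have "of_bool (\<not> good xs) \<le> (1::real)" by simp
      ultimately show ?thesis by linarith
    next
      case False
      have st: "stays Y xs" unfolding Y_def by (rule stays_box[OF xs]) simp
      have tot: "(\<Sum>y\<in>Y. real (loc xs y)) = real n + 1"
        using sum_loc_stays[OF Y st] xs by (simp add: step_lists_def flip: of_nat_sum)
      have cubes: "(\<Sum>y\<in>Y \<inter> cube z j. real (loc xs y)) \<le> u * 4 ^ j" if "z \<in> Y" for z j
      proof (cases "j < n")
        case True
        have "(\<Sum>y\<in>Y \<inter> cube z j. real (loc xs y)) \<le> (\<Sum>y\<in>cube z j. real (loc xs y))"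
          by (intro sum_mono2) (auto simp: finite_cube)
        then show ?thesis using False True that by force
      next
        case False
        have "(\<Sum>y\<in>Y \<inter> cube z j. real (loc xs y)) \<le> (\<Sum>y\<in>Y. real (loc xs y))"
          using Y by (intro sum_mono2) auto
        also have "\<dots> = real (n + 1)" using tot by simp
        also have "\<dots> \<le> 2 ^ n"
        proof -
          have "n + 1 \<le> 2 ^ n" using less_exp[of n] by linarith
          then show ?thesis by (metis of_nat_le_iff of_nat_numeral of_nat_power)
        qed
        also have "\<dots> \<le> (4::real) ^ n" by (intro power_mono) auto
        also have "\<dots> \<le> 4 ^ j" using False by (intro power_increasing) auto
        also have "\<dots> \<le> u * 4 ^ j" using u by simp
        finally show ?thesis .
      qed
      have "(\<Sum>y\<in>Y. G (z - y) * \<phi> (loc xs y)) \<le> L" if z: "z \<in> Y" for z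
      proof -
        have "(\<Sum>y\<in>Y. G (z - y) * \<phi> (loc xs y)) \<le> (\<Sum>y\<in>Y. G (z - y) * (B * real (loc xs y) powr q))"
          by (intro sum_mono mult_left_mono phi_le G_nonneg)
        also have "\<dots> = B * (\<Sum>y\<in>Y. G (z - y) * real (loc xs y) powr q)"
          by (simp add: sum_distrib_left mult_ac)
        also have "\<dots> \<le> B * (K1 * u powr q)"
        proof (rule mult_left_mono)
          show "(\<Sum>y\<in>Y. G (z - y) * real (loc xs y) powr q) \<le> K1 * u powr q"
            using pot[rule_format, of Y u "\<lambda>y. real (loc xs y)" z] Y u cubes z by auto
        qed (use B in simp)
        also have "\<dots> \<le> L" using K B by (simp add: L_def mult_right_mono)
        finally show ?thesis .
      qed
      then have "good xs" using st by (simp add: good_def)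
      then show ?thesis by (auto intro!: sum_nonneg)
    qed
    have "\<P>(\<omega> in srw_steps. (\<Sum>\<^sub>\<infinity>x::int^'d. real (local_time (walk \<omega>) n x) powr p) > A)
        = \<P>(\<omega> in srw_steps. big (steps_upto n \<omega>))"
      by (simp add: big_def loc_steps_upto)
    also have "\<dots> = avg n (\<lambda>xs. of_bool (big xs))" by (rule prob_steps_eq_avg(1))
    also have "\<dots> \<le> avg n (\<lambda>xs. exp (- X) * (of_bool (good xs) * exp ((\<Sum>y\<in>Y. \<Sum>j=1..loc xs y. \<psi> j) / L))
       + (\<Sum>w\<in>Y. \<Sum>i<n. of_bool (u * 4 ^ i < (\<Sum>y\<in>cube w i. real (loc xs y)))))"
    proof (rule avg_mono)
      fix xs :: "(int ^ 'd) list" assume xs: "xs \<in> step_lists n"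
      have "of_bool (big xs) \<le> of_bool (good xs \<and> big xs) + (of_bool (\<not> good xs) :: real)" by auto
      with good_big[OF xs] not_good[OF xs]
      show "of_bool (big xs) \<le> exp (- X) * (of_bool (good xs) * exp ((\<Sum>y\<in>Y. \<Sum>j=1..loc xs y. \<psi> j) / L))
       + (\<Sum>w\<in>Y. \<Sum>i<n. of_bool (u * 4 ^ i < (\<Sum>y\<in>cube w i. real (loc xs y))))"
        by linarith
    qed
    also have "\<dots> = exp (- X) * avg n (\<lambda>xs. of_bool (good xs) * exp ((\<Sum>y\<in>Y. \<Sum>j=1..loc xs y. \<psi> j) / L))
       + (\<Sum>w\<in>Y. \<Sum>i<n. avg n (\<lambda>xs. of_bool (u * 4 ^ i < (\<Sum>y\<in>cube w i. real (loc xs y)))))"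
      by (simp only: avg_add avg_cmult avg_sum)
    also have "\<dots> \<le> exp (- X) * 4 + (\<Sum>w\<in>Y. \<Sum>i<n. 4 * exp (- c * u))"
      by (intro add_mono mult_left_mono avg4 sum_mono occ) auto
    also have "(\<Sum>w\<in>Y. \<Sum>i<n. 4 * exp (- c * u)) = card Y * (n * (4 * exp (- c * u)))"
      by simp
    also have "\<dots> \<le> (2 * real n + 2) ^ CARD('d) * (n * (4 * exp (- c * u)))"
    proof (rule mult_right_mono)
      have "card Y \<le> (2 * Suc n) ^ CARD('d)" unfolding Y_def by (rule card_box)
      then have "real (card Y) \<le> real ((2 * Suc n) ^ CARD('d))" by (subst of_nat_le_iff)
      then show "real (card Y) \<le> (2 * real n + 2) ^ CARD('d)" by (simp add: add.commute)
    qed auto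
    finally have "\<P>(\<omega> in srw_steps. (\<Sum>\<^sub>\<infinity>x::int^'d. real (local_time (walk \<omega>) n x) powr p) > A)
        \<le> exp (- X) * 4 + (2 * real n + 2) ^ CARD('d) * (n * (4 * exp (- c * u)))" by simp
    moreover have "- (A / (4 * p) - (s / 2 + K) * (real n + 1)) / (K * B * u powr q) = - X"
      by (simp only: X_def L_def minus_divide_left)
    ultimately show "\<P>(\<omega> in srw_steps. (\<Sum>\<^sub>\<infinity>x::int^'d. real (local_time (walk \<omega>) n x) powr p) > A)
        \<le> 4 * exp (- (A / (4 * p) - (s / 2 + K) * (real n + 1)) / (K * B * u powr q))
          + (2 * real n + 2) ^ CARD('d) * real n * (4 * exp (- c * u))"
      by (simp only: mult_ac)
  qed
qed

end

section \<open>The two regimes\<close>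

lemma green_majorant_exists:
  assumes "CARD('d::finite) \<ge> 3"
  shows "\<exists>(G :: int ^ 'd \<Rightarrow> real) C. green_majorant G C"
proof (rule ex_green_majorant[OF assms])
  fix G :: "int ^ 'd \<Rightarrow> real" and C
  assume "\<And>x. G x \<ge> 0"
    "\<And>x. (\<Sum>s\<in>unit_steps. G (x + s)) / (2 * CARD('d)) \<le> G x - of_bool (x = 0)"
    "C > 0" "\<And>x. G x \<le> C" "\<And>x i. x \<notin> cube 0 i \<Longrightarrow> G x \<le> C * (1 / 2 ^ (CARD('d) - 2)) ^ i"
  then have "green_majorant G C" using assms by unfold_locales
  then show ?thesis by blast
qed

text \<open>Half of the smaller rate pays for the polynomial factor.\<close>

lemma eventually_poly_exp_le:
  fixes a c1 c2 :: real
  assumes "a > 0" "c1 > 0" "c2 > 0"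
  shows "\<exists>c>0. \<forall>\<^sub>F n in sequentially. 4 * exp (- (c1 * real n powr a))
      + (2 * real n + 2) ^ k * real n * (4 * exp (- c2 * real n powr a)) \<le> exp (- c * real n powr a)"
proof -
  define c where "c = min c1 c2 / 2"
  have c: "c > 0" "2 * c \<le> c1" "2 * c \<le> c2" using assms by (auto simp: c_def)
  have "\<forall>\<^sub>F n::nat in sequentially. 4 + (2 * real n + 2) ^ k * real n * 4 \<le> exp (c * real n powr a)"
    using assms(1) c(1) by real_asymp
  then have "\<forall>\<^sub>F n in sequentially. 4 * exp (- (c1 * real n powr a))
      + (2 * real n + 2) ^ k * real n * (4 * exp (- c2 * real n powr a)) \<le> exp (- c * real n powr a)"
  proof eventually_elim
    case (elim n)
    let ?E = "exp (- (2 * c * real n powr a))"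
    have "exp (- (c1 * real n powr a)) \<le> ?E" "exp (- c2 * real n powr a) \<le> ?E"
      using c by (auto intro!: mult_right_mono)
    then have "4 * exp (- (c1 * real n powr a)) + (2 * real n + 2) ^ k * real n * (4 * exp (- c2 * real n powr a))
        \<le> 4 * ?E + (2 * real n + 2) ^ k * real n * (4 * ?E)"
      by (intro add_mono mult_left_mono) auto
    also have "\<dots> = (4 + (2 * real n + 2) ^ k * real n * 4) * ?E"
      by (simp add: algebra_simps)
    also have "\<dots> \<le> exp (c * real n powr a) * ?E"
      using elim by (intro mult_right_mono) auto
    also have "\<dots> = exp (- c * real n powr a)"
      by (simp flip: exp_add)
    finally show ?case .
  qed
  with c(1) show ?thesis by blast
qed

abbreviation tail_prob :: "'d::finite itself \<Rightarrow> real \<Rightarrow> real \<Rightarrow> nat \<Rightarrow> real" where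
  "tail_prob _ p \<gamma> n \<equiv>
     \<P>(\<omega> in srw_steps. (\<Sum>\<^sub>\<infinity>x::int^'d. real (local_time (walk \<omega>) n x) powr p) > real n powr \<gamma>)"

text \<open>No truncation (\<open>s = 0\<close>, \<open>B = 1\<close>):
  \<open>p > d / (d - 2)\<close> says that \<open>q = p - 1\<close> is above the threshold
  \<open>2 / (d - 2)\<close>. The choice of \<open>u\<close> makes the two rates equal in order, as
  \<open>n powr \<gamma> / u powr (p - 1) = u\<close>.\<close>

lemma tail_upper_supercritical:
  fixes p \<gamma> d :: real
  assumes d5: "CARD('d::finite) \<ge> 5" and d: "d = real CARD('d)"
    and p: "p > d / (d - 2)" and \<gamma>: "\<gamma> > 1"
  shows "\<exists>c>0. \<forall>\<^sub>F n in sequentially. tail_prob TYPE('d) p \<gamma> n \<le> exp (- c * real n powr (\<gamma> / p))"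
proof -
  obtain G :: "int ^ 'd \<Rightarrow> real" and C where "green_majorant G C"
    using green_majorant_exists[where 'd = 'd] d5 by auto
  then interpret green_majorant G C .
  have d5': "d \<ge> 5" using d5 d by simp
  have "d / (d - 2) > 1" using d5' by simp
  then have p1: "p > 1" using p by linarith
  have q: "p - 1 > 2 / (real CARD('d) - 2)"
    using p d5' by (simp add: d[symmetric] field_simps)
  obtain c K where c: "c > 0" and K: "K > 0" and bound: "\<forall>n u A s B. u \<ge> 1 \<longrightarrow> s \<ge> 0 \<longrightarrow> B > 0 \<longrightarrow>
      (\<forall>j::nat. real j powr (p - 1) - s \<le> B * real j powr (p - 1)) \<longrightarrow>
      \<P>(\<omega> in srw_steps. (\<Sum>\<^sub>\<infinity>x::int^'d. real (local_time (walk \<omega>) n x) powr p) > A)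
        \<le> 4 * exp (- (A / (4 * p) - (s / 2 + K) * (real n + 1)) / (K * B * u powr (p - 1)))
          + (2 * real n + 2) ^ CARD('d) * real n * (4 * exp (- c * u))"
    using prob_sum_local_time_powr_le[OF d5 p1 q] by blast
  define c1 where "c1 = 1 / (8 * p * K)"
  have c1: "c1 > 0" using p1 K by (simp add: c1_def)
  have a: "\<gamma> / p > 0" using \<gamma> p1 by simp
  obtain c' where c': "c' > 0" and ev: "\<forall>\<^sub>F n in sequentially. 4 * exp (- (c1 * real n powr (\<gamma> / p)))
      + (2 * real n + 2) ^ CARD('d) * real n * (4 * exp (- c * real n powr (\<gamma> / p))) \<le> exp (- c' * real n powr (\<gamma> / p))"
    using eventually_poly_exp_le[OF a c1 c] by blast
  have "8 * p * K > 0" using p1 K by simp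
  then have ev2: "\<forall>\<^sub>F n::nat in sequentially. (8 * p * K) * (real n + 1) \<le> real n powr \<gamma>"
    using \<gamma> by real_asymp
  have "\<forall>\<^sub>F n in sequentially. tail_prob TYPE('d) p \<gamma> n \<le> exp (- c' * real n powr (\<gamma> / p))"
    using ev ev2 eventually_ge_at_top[of 1]
  proof eventually_elim
    case (elim n)
    define u where "u = real n powr (\<gamma> / p)"
    have u: "u \<ge> 1" using elim a by (simp add: u_def ge_one_powr_ge_zero)
    have ug: "real n powr \<gamma> = u powr (p - 1) * u"
      using u p1 by (simp add: u_def powr_powr powr_diff)
    have "tail_prob TYPE('d) p \<gamma> n \<le> 4 * exp (- (real n powr \<gamma> / (4 * p) - (0 / 2 + K) * (real n + 1)) / (K * 1 * u powr (p - 1)))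
          + (2 * real n + 2) ^ CARD('d) * real n * (4 * exp (- c * u))"
      using u by (intro bound[rule_format]) auto
    also have "4 * exp (- (real n powr \<gamma> / (4 * p) - (0 / 2 + K) * (real n + 1)) / (K * 1 * u powr (p - 1)))
        \<le> 4 * exp (- (c1 * u))"
    proof -
      have "K * (real n + 1) \<le> real n powr \<gamma> / (8 * p)"
        using elim(2) p1 by (simp add: field_simps)
      moreover have "real n powr \<gamma> / (4 * p) = real n powr \<gamma> / (8 * p) + real n powr \<gamma> / (8 * p)"
        by simp
      ultimately have "real n powr \<gamma> / (8 * p) \<le> real n powr \<gamma> / (4 * p) - (0 / 2 + K) * (real n + 1)"
        by simp
      then have "real n powr \<gamma> / (8 * p) / (K * 1 * u powr (p - 1)) \<le>
          (real n powr \<gamma> / (4 * p) - (0 / 2 + K) * (real n + 1)) / (K * 1 * u powr (p - 1))"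
        using K by (intro divide_right_mono) auto
      moreover have "real n powr \<gamma> / (8 * p) / (K * 1 * u powr (p - 1)) = c1 * u"
        using u by (simp add: ug c1_def)
      ultimately have "c1 * u \<le> (real n powr \<gamma> / (4 * p) - (0 / 2 + K) * (real n + 1)) / (K * 1 * u powr (p - 1))"
        by linarith
      then show ?thesis
        by (simp only: minus_divide_left[symmetric] exp_le_cancel_iff neg_le_iff_le mult_le_cancel_left_pos
            zero_less_numeral)
    qed
    finally show ?case using elim(1) unfolding u_def by linarith
  qed
  with c' show ?thesis by blast
qed

lemma tail_upper_subcritical:
  fixes p \<gamma> d \<zeta> \<epsilon> :: real
  assumes d5: "CARD('d::finite) \<ge> 5" and d: "d = real CARD('d)"
    and p: "1 < p" "p \<le> d / (d - 2)" and \<gamma>: "\<gamma> > 1" "\<gamma> < p"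
    and \<zeta>: "\<zeta> = 1 - 2 / d * ((p - \<gamma>) / (p - 1))" and \<epsilon>: "\<epsilon> > 0"
  shows "\<exists>c>0. \<forall>\<^sub>F n in sequentially. tail_prob TYPE('d) p \<gamma> n \<le> exp (- c * real n powr (\<zeta> - \<epsilon>))"
proof -
  obtain G :: "int ^ 'd \<Rightarrow> real" and C where "green_majorant G C"
    using green_majorant_exists[where 'd = 'd] d5 by auto
  then interpret green_majorant G C .
  have d5': "d \<ge> 5" using d5 d by simp
  \<comment> \<open>Heuristically, the walk spends a time of order n on
    \<open>n powr (1 - \<tau>)\<close> sites, with local time \<open>n powr \<tau>\<close> at each;
    their power sum is of order \<open>n powr \<gamma>\<close>.\<close>
  define \<tau> where "\<tau> = (\<gamma> - 1) / (p - 1)"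
  have tau: "0 < \<tau>" "\<tau> < 1" "\<tau> * (p - 1) = \<gamma> - 1"
    using p \<gamma> by (auto simp: \<tau>_def)
  have "(p - \<gamma>) / (p - 1) = 1 - \<tau>" using p by (simp add: \<tau>_def field_simps)
  then have zeta: "\<zeta> = 1 - 2 / d * (1 - \<tau>)" by (simp add: \<zeta>)
  have "2 / d * (1 - \<tau>) < 1 * 1"
    using tau d5' by (intro mult_strict_mono) auto
  then have zeta0: "\<zeta> > 0" by (simp add: zeta)
  \<comment> \<open>Capped so that \<open>\<zeta> - \<epsilon>'\<close> stays positive and the
    exponential still absorbs polynomial factors.\<close>
  define \<epsilon>' where "\<epsilon>' = min \<epsilon> (\<zeta> / 2)"
  have eps: "\<epsilon>' > 0" "\<epsilon>' \<le> \<epsilon>" "\<zeta> - \<epsilon>' > 0" using \<epsilon> zeta0 by (auto simp: \<epsilon>'_def)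
  define q where "q = 2 / (d - 2) + \<epsilon>'"
  have q: "q > 2 / (real CARD('d) - 2)" using eps by (simp add: q_def d)
  have "p - 1 \<le> d / (d - 2) - 1" using p by simp
  also have "\<dots> = 2 / (d - 2)" using d5' by (simp add: field_simps)
  finally have pq: "p - 1 \<le> q" using eps by (simp add: q_def)
  \<comment> \<open>The right-hand side is the exponent of the first rate. At
    \<open>q = 2 / (d - 2)\<close> it equals \<open>\<zeta>\<close>, and the excess
    \<open>\<epsilon>'\<close> in \<open>q\<close> costs at most \<open>\<epsilon>'\<close> because
    \<open>\<zeta> - \<tau> \<le> 1\<close>.\<close>
  have e1: "\<zeta> - \<epsilon>' \<le> 1 + q * (\<tau> - \<zeta>)"
  proof -
    have zt: "\<zeta> - \<tau> = (1 - \<tau>) * ((d - 2) / d)"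
      using d5' by (simp add: zeta field_simps)
    have "2 / (d - 2) * (\<zeta> - \<tau>) = 2 / d * (1 - \<tau>)"
      unfolding zt using d5' by (simp add: field_simps)
    then have "1 - 2 / (d - 2) * (\<zeta> - \<tau>) = \<zeta>" by (simp add: zeta)
    moreover have "(1 - \<tau>) * ((d - 2) / d) \<le> 1 * 1"
      using tau d5' by (intro mult_mono) auto
    then have "\<epsilon>' * (\<zeta> - \<tau>) \<le> \<epsilon>' * 1"
      unfolding zt using eps by (intro mult_left_mono) auto
    moreover have "q * (\<tau> - \<zeta>) = - (q * (\<zeta> - \<tau>))" by (simp add: right_diff_distrib)
    moreover have "q * (\<zeta> - \<tau>) = 2 / (d - 2) * (\<zeta> - \<tau>) + \<epsilon>' * (\<zeta> - \<tau>)"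
      by (simp only: q_def distrib_right)
    ultimately show ?thesis by linarith
  qed
  \<comment> \<open>Chosen so that \<open>(p - 1) * (1 + \<eta>) = q\<close>: where
    \<open>j powr (p - 1) > s\<close>, the factor \<open>(j powr (p - 1) / s) powr \<eta>\<close> is
    at least 1 and raises the exponent \<open>p - 1\<close> to \<open>q\<close> at the price
    \<open>B = s powr (- \<eta>)\<close>.\<close>
  define \<eta> where "\<eta> = (q - p + 1) / (p - 1)"
  have eta: "\<eta> \<ge> 0" "(p - 1) * \<eta> = q - p + 1" using pq p by (auto simp: \<eta>_def)
  obtain c K where c: "c > 0" and K: "K > 0" and bound: "\<forall>n u A s B. u \<ge> 1 \<longrightarrow> s \<ge> 0 \<longrightarrow> B > 0 \<longrightarrow>
      (\<forall>j::nat. real j powr (p - 1) - s \<le> B * real j powr q) \<longrightarrow>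
      \<P>(\<omega> in srw_steps. (\<Sum>\<^sub>\<infinity>x::int^'d. real (local_time (walk \<omega>) n x) powr p) > A)
        \<le> 4 * exp (- (A / (4 * p) - (s / 2 + K) * (real n + 1)) / (K * B * u powr q))
          + (2 * real n + 2) ^ CARD('d) * real n * (4 * exp (- c * u))"
    using prob_sum_local_time_powr_le[OF d5 p(1) q] by blast
  define c1 where "c1 = 1 / (16 * p * K * (8 * p) powr \<eta>)"
  have c1: "c1 > 0" using p K by (simp add: c1_def)
  obtain c' where c': "c' > 0" and ev: "\<forall>\<^sub>F n in sequentially. 4 * exp (- (c1 * real n powr (\<zeta> - \<epsilon>')))
      + (2 * real n + 2) ^ CARD('d) * real n * (4 * exp (- c * real n powr (\<zeta> - \<epsilon>'))) \<le> exp (- c' * real n powr (\<zeta> - \<epsilon>'))"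
    using eventually_poly_exp_le[OF eps(3) c1 c] by blast
  have "16 * p * K > 0" using p K by simp
  then have ev2: "\<forall>\<^sub>F n::nat in sequentially. (16 * p * K) * (real n + 1) \<le> real n powr \<gamma>"
    using \<gamma> by real_asymp
  have "\<forall>\<^sub>F n in sequentially. tail_prob TYPE('d) p \<gamma> n \<le> exp (- c' * real n powr (\<zeta> - \<epsilon>))"
    using ev ev2 eventually_ge_at_top[of 1]
  proof eventually_elim
    case (elim n)
    define u where "u = real n powr \<zeta>"
    \<comment> \<open>The truncation loss \<open>(s / 2) * (n + 1)\<close> is then at most
      \<open>n powr \<gamma> / (8 * p)\<close>, half of the main term; another quarter of it pays
      for \<open>K * (n + 1)\<close>.\<close>
    define s where "s = real n powr (\<gamma> - 1) / (8 * p)"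
    define B where "B = s powr (- \<eta>)"
    have n: "real n \<ge> 1" using elim by simp
    have u: "u \<ge> 1" using n zeta0 by (simp add: u_def ge_one_powr_ge_zero)
    have s: "s > 0" using n p by (simp add: s_def)
    have B: "B > 0" using s by (simp add: B_def)
    have weight: "real j powr (p - 1) - s \<le> B * real j powr q" for j :: nat
    proof (cases "real j powr (p - 1) \<le> s")
      case True
      moreover have "B * real j powr q \<ge> 0" using B by simp
      ultimately show ?thesis by linarith
    next
      case False
      then have "s powr \<eta> \<le> (real j powr (p - 1)) powr \<eta>"
        using s eta by (intro powr_mono2) auto
      also have "\<dots> = real j powr (q - p + 1)" by (simp add: powr_powr eta)
      finally have "B * s powr \<eta> \<le> B * real j powr (q - p + 1)"
        using B by (intro mult_left_mono) auto
      moreover have "B * s powr \<eta> = 1" using s by (simp add: B_def powr_minus)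
      ultimately have "1 \<le> B * real j powr (q - p + 1)" by simp
      then have "1 * real j powr (p - 1) \<le> B * real j powr (q - p + 1) * real j powr (p - 1)"
        by (intro mult_right_mono) auto
      moreover have "real j powr (q - p + 1) * real j powr (p - 1) = real j powr q"
        by (simp only: powr_add[symmetric]) simp
      ultimately show ?thesis using s by (simp add: mult.assoc)
    qed
    have "tail_prob TYPE('d) p \<gamma> n \<le> 4 * exp (- (real n powr \<gamma> / (4 * p) - (s / 2 + K) * (real n + 1)) / (K * B * u powr q))
          + (2 * real n + 2) ^ CARD('d) * real n * (4 * exp (- c * u))"
      using u s B weight by (intro bound[rule_format]) auto
    also have "\<dots> \<le> 4 * exp (- (c1 * real n powr (\<zeta> - \<epsilon>'))) + (2 * real n + 2) ^ CARD('d) * real n * (4 * exp (- c * real n powr (\<zeta> - \<epsilon>')))"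
    proof (intro add_mono mult_left_mono)
      have "real n powr (\<zeta> - \<epsilon>') \<le> u"
        unfolding u_def using n eps by (intro powr_mono) auto
      then show "exp (- c * u) \<le> exp (- c * real n powr (\<zeta> - \<epsilon>'))" using c by simp
      have "real n powr (\<gamma> - 1) * real n = real n powr \<gamma>"
        using n by (simp add: powr_diff)
      then have "s * real n = real n powr \<gamma> / (8 * p)" by (simp add: s_def)
      moreover have "s * (real n + 1) \<le> s * (2 * real n)" using s n by (intro mult_left_mono) auto
      moreover have "K * (real n + 1) \<le> real n powr \<gamma> / (16 * p)"
        using elim(2) p by (simp add: field_simps)
      moreover have "real n powr \<gamma> / (4 * p) = real n powr \<gamma> / (8 * p) + (real n powr \<gamma> / (16 * p) + real n powr \<gamma> / (16 * p))"
        by simp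
      ultimately have "real n powr \<gamma> / (16 * p) \<le> real n powr \<gamma> / (4 * p) - (s / 2 + K) * (real n + 1)"
        by (simp add: distrib_right)
      then have "real n powr \<gamma> / (16 * p) / (K * B * u powr q) \<le>
          (real n powr \<gamma> / (4 * p) - (s / 2 + K) * (real n + 1)) / (K * B * u powr q)"
        using K B by (intro divide_right_mono) auto
      moreover have "real n powr \<gamma> / (16 * p) / (K * B * u powr q) = c1 * real n powr (1 + q * (\<tau> - \<zeta>))"
      proof -
        have "s powr \<eta> = real n powr ((\<gamma> - 1) * \<eta>) / (8 * p) powr \<eta>"
          using p by (simp add: s_def powr_divide powr_powr)
        then have B': "1 / B = real n powr ((\<gamma> - 1) * \<eta>) / (8 * p) powr \<eta>"
          by (simp add: B_def powr_minus_divide)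
        have "real n powr \<gamma> / (16 * p) / (K * B * u powr q)
          = real n powr \<gamma> / (16 * p * K * u powr q) * (1 / B)"
          by (simp add: mult_ac)
        also have "\<dots> = c1 * (real n powr \<gamma> * real n powr ((\<gamma> - 1) * \<eta>) / u powr q)"
          unfolding B' c1_def by (simp add: mult_ac)
        also have "real n powr \<gamma> * real n powr ((\<gamma> - 1) * \<eta>) / u powr q
            = real n powr (\<gamma> + (\<gamma> - 1) * \<eta> - \<zeta> * q)"
          by (simp add: u_def powr_powr powr_add powr_diff)
        also have "\<gamma> + (\<gamma> - 1) * \<eta> - \<zeta> * q = 1 + q * (\<tau> - \<zeta>)"
        proof -
          have "(\<gamma> - 1) * \<eta> = \<tau> * ((p - 1) * \<eta>)" using tau(3) by (simp add: mult.assoc[symmetric])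
          also have "\<dots> = \<tau> * q - \<tau> * (p - 1)" unfolding eta(2) by (simp add: algebra_simps)
          finally show ?thesis using tau(3) by (simp add: algebra_simps)
        qed
        finally show ?thesis .
      qed
      moreover have "c1 * real n powr (\<zeta> - \<epsilon>') \<le> c1 * real n powr (1 + q * (\<tau> - \<zeta>))"
        using n e1 c1 by (intro mult_left_mono powr_mono) auto
      ultimately have "c1 * real n powr (\<zeta> - \<epsilon>') \<le>
          (real n powr \<gamma> / (4 * p) - (s / 2 + K) * (real n + 1)) / (K * B * u powr q)" by linarith
      then show "exp (- (real n powr \<gamma> / (4 * p) - (s / 2 + K) * (real n + 1)) / (K * B * u powr q))
          \<le> exp (- (c1 * real n powr (\<zeta> - \<epsilon>')))"
        by (simp only: minus_divide_left[symmetric] exp_le_cancel_iff neg_le_iff_le)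
    qed auto
    also have "\<dots> \<le> exp (- c' * real n powr (\<zeta> - \<epsilon>'))" by (rule elim(1))
    also have "\<dots> \<le> exp (- c' * real n powr (\<zeta> - \<epsilon>))"
      using n eps c' by (simp add: powr_mono)
    finally show ?case .
  qed
  with c' show ?thesis by blast
qed

section \<open>Lower bounds\<close>

lemma tail_lower_two_points:
  fixes p \<gamma> :: real
  assumes p: "p > 1" and \<gamma>: "1 < \<gamma>" "\<gamma> < p"
  shows "\<exists>c>0. \<forall>\<^sub>F n in sequentially. exp (- c * real n powr (\<gamma> / p)) \<le> tail_prob TYPE('d::finite) p \<gamma> n"
proof -
  define b where "b = real (2 * CARD('d))"
  have "CARD('d) > 0" by simp
  then have "real CARD('d) \<ge> 1" by linarith
  then have b: "b > 1" unfolding b_def of_nat_mult of_nat_numeral by linarith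
  have a: "\<gamma> / p > 0" "\<gamma> / p < 1" using p \<gamma> by auto
  then have "\<forall>\<^sub>F n::nat in sequentially. 2 * real n powr (\<gamma> / p) + 1 \<le> real n"
    by real_asymp
  then have "\<forall>\<^sub>F n in sequentially. exp (- (3 * ln b) * real n powr (\<gamma> / p)) \<le> tail_prob TYPE('d) p \<gamma> n"
    using eventually_ge_at_top[of 1]
  proof eventually_elim
    case (elim n)
    define v where "v = real n powr (\<gamma> / p)"
    have v: "v \<ge> 1" using elim a by (simp add: v_def ge_one_powr_ge_zero)
    \<comment> \<open>The factor 2 makes up for sharing the time between two sites:
      \<open>(2 * v) powr p * 2 powr (1 - p) = 2 * v powr p\<close>, strictly above
      \<open>n powr \<gamma> = v powr p\<close>.\<close>
    define m where "m = nat \<lceil>2 * v\<rceil>"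
    have m: "2 * v \<le> real m" "real m \<le> 2 * v + 1" using v by (auto simp: m_def)
    have "exp (- (3 * ln b) * v) \<le> exp (- (real m * ln b))"
    proof -
      have "real m * ln b \<le> 3 * v * ln b" using m v b by (intro mult_right_mono) auto
      then show ?thesis by (simp add: mult_ac)
    qed
    also have "\<dots> = (1 / b) ^ m"
      using b by (simp add: exp_minus exp_of_nat_mult power_one_over inverse_eq_divide)
    also have "\<dots> \<le> tail_prob TYPE('d) p \<gamma> n"
      unfolding b_def
    proof (rule prob_ge_two_points[OF p])
      show "m \<le> n" using m elim by (simp add: v_def)
      have "real n powr \<gamma> = v powr p" using p by (simp add: v_def powr_powr)
      also have "\<dots> < 2 * v powr p" using v by simp
      also have "\<dots> = (2 * v) powr p * 2 powr (1 - p)"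
        using v by (simp add: powr_mult powr_diff)
      also have "\<dots> \<le> (real m + 1) powr p * 2 powr (1 - p)"
        using m v p by (intro mult_right_mono powr_mono2) auto
      finally show "real n powr \<gamma> < (real m + 1) powr p * 2 powr (1 - p)" .
    qed
    finally show ?case by (simp add: v_def)
  qed
  moreover have "3 * ln b > 0" using b by simp
  ultimately show ?thesis by blast
qed

text \<open>Combines cos x >= 1 - x^2 / 2 with 1 - y >= exp(-2 y) for y <= 1/2;
  \<open>R \<ge> 2\<close> keeps the angle below 1.\<close>

lemma cos_power_ge_exp:
  fixes R n :: nat
  assumes "R \<ge> 2"
  shows "exp (- (pi\<^sup>2 * n / (4 * (real R)\<^sup>2))) \<le> cos (pi / (2 * R)) ^ n"
proof -
  define y where "y = (pi / (2 * R))\<^sup>2 / 2"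
  have "pi / (2 * R) \<le> pi / 4" using assms by (intro divide_left_mono) auto
  also have "\<dots> \<le> 1" using pi_less_4 by simp
  finally have "pi / (2 * R) \<le> 1" .
  then have "(pi / (2 * R))\<^sup>2 \<le> 1" by (simp add: power_le_one_iff)
  then have y: "0 \<le> y" "y \<le> 1 / 2" by (auto simp: y_def)
  have "2 * y\<^sup>2 \<le> y" using y mult_right_mono[of y "1/2" y] by (simp add: power2_eq_square)
  then have "- (2 * y) \<le> - y - 2 * y\<^sup>2" by simp
  also have "\<dots> \<le> ln (1 - y)" using y by (intro ln_one_minus_pos_lower_bound)
  finally have "exp (- (2 * y)) \<le> 1 - y" using y by (subst (asm) ln_ge_iff) auto
  also have "\<dots> \<le> cos (pi / (2 * R))"
  proof -
    let ?x = "pi / (4 * R)"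
    have "cos (pi / (2 * R)) = cos (2 * ?x)" by simp
    also have "\<dots> = 1 - 2 * (sin ?x)\<^sup>2" by (rule cos_double_sin)
    finally have "cos (pi / (2 * R)) = 1 - 2 * (sin ?x)\<^sup>2" .
    moreover have "(sin ?x)\<^sup>2 \<le> ?x\<^sup>2"
      using abs_sin_x_le_abs_x[of ?x] by (simp only: abs_le_square_iff)
    moreover have "y = 2 * ?x\<^sup>2" by (simp add: y_def power_divide power_mult_distrib)
    ultimately show ?thesis by linarith
  qed
  finally have "exp (- (2 * y)) ^ n \<le> cos (pi / (2 * R)) ^ n" by (intro power_mono) auto
  moreover have "exp (- (2 * y)) ^ n = exp (- (pi\<^sup>2 * n / (4 * (real R)\<^sup>2)))"
    by (simp add: y_def power_divide power_mult_distrib flip: exp_of_nat_mult)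
  ultimately show ?thesis by simp
qed

lemma tail_lower_cube:
  fixes p \<gamma> d \<zeta> :: real
  assumes d: "d = real CARD('d::finite)" and p: "p > 1" and \<gamma>: "1 < \<gamma>" "\<gamma> < p"
    and \<zeta>: "\<zeta> = 1 - 2 / d * ((p - \<gamma>) / (p - 1))"
  shows "\<exists>c>0. \<forall>\<^sub>F n in sequentially. exp (- c * real n powr \<zeta>) \<le> tail_prob TYPE('d) p \<gamma> n"
proof -
  \<comment> \<open>A cube of side \<open>n powr b\<close> has about
    \<open>n powr ((p - \<gamma>) / (p - 1))\<close> sites, the size at which Jensen's bound equals
    \<open>n powr \<gamma>\<close>; confinement to it for time n costs a rate of order
    \<open>n powr (1 - 2 * b) = n powr \<zeta>\<close>.\<close>
  define b where "b = (p - \<gamma>) / (d * (p - 1))"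
  have "CARD('d) > 0" by simp
  then have d0: "d > 0" unfolding d by linarith
  have b: "b > 0" "b * d * (p - 1) = p - \<gamma>" "\<zeta> = 1 - 2 * b"
    using p \<gamma> d0 by (auto simp: b_def \<zeta> field_simps)
  have "\<forall>\<^sub>F n::nat in sequentially. real n powr b \<ge> 8"
    using b(1) by real_asymp
  then have "\<forall>\<^sub>F n in sequentially. exp (- (4 * pi\<^sup>2) * real n powr \<zeta>) \<le> tail_prob TYPE('d) p \<gamma> n"
    using eventually_ge_at_top[of 1]
  proof eventually_elim
    case (elim n)
    define v where "v = real n powr b"
    have v: "v \<ge> 8" using elim by (simp add: v_def)
    have n: "real n \<ge> 1" using elim by simp
    \<comment> \<open>Rounding down keeps \<open>2 * R \<le> v\<close>, so there are not too many
      sites, and \<open>v \<ge> 8\<close> keeps \<open>R \<ge> v / 4\<close>. The strict inequality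
      needed in the end comes from \<open>n + 1 > n\<close>.\<close>
    define R where "R = nat \<lfloor>v / 2\<rfloor>"
    have R: "real R \<le> v / 2" "v / 2 - 1 \<le> real R" using v by (auto simp: R_def) linarith
    have R2: "R \<ge> 2" using R v by linarith
    have "v / 4 \<le> real R" using R v by linarith
    then have "(v / 4)\<^sup>2 \<le> (real R)\<^sup>2" using v by (intro power_mono) auto
    then have "pi\<^sup>2 * n / (4 * (real R)\<^sup>2) \<le> pi\<^sup>2 * n / (4 * (v / 4)\<^sup>2)"
      using v R2 by (intro divide_left_mono mult_left_mono) auto
    also have "\<dots> = 4 * pi\<^sup>2 * (n / v\<^sup>2)" by (simp add: power2_eq_square)
    also have "n / v\<^sup>2 = real n powr \<zeta>"
    proof -
      have "v\<^sup>2 = real n powr (2 * b)"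
        using n by (simp add: v_def powr_powr flip: powr_realpow) (simp add: mult.commute)
      then show ?thesis using n by (simp add: b(3) powr_diff)
    qed
    finally have "exp (- (4 * pi\<^sup>2) * real n powr \<zeta>) \<le> exp (- (pi\<^sup>2 * n / (4 * (real R)\<^sup>2)))"
      by simp
    also have "\<dots> \<le> cos (pi / (2 * R)) ^ n" by (rule cos_power_ge_exp[OF R2])
    also have "\<dots> \<le> tail_prob TYPE('d) p \<gamma> n"
    proof (rule prob_ge_cube[OF p])
      show "R \<ge> 1" using R2 by simp
      have "v powr d = v ^ CARD('d)" using v by (simp add: d powr_realpow)
      moreover have "(2 * real R) ^ CARD('d) \<le> v ^ CARD('d)" using R by (intro power_mono) auto
      ultimately have "(v powr d) powr (1 - p) \<le> ((2 * real R) ^ CARD('d)) powr (1 - p)"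
        using R2 p by (intro powr_mono2') auto
      moreover have "(v powr d) powr (1 - p) = real n powr (\<gamma> - p)"
      proof -
        have "(v powr d) powr (1 - p) = real n powr (b * d * (1 - p))" by (simp add: v_def powr_powr mult.assoc)
        also have "b * d * (1 - p) = - (b * d * (p - 1))" by (simp add: algebra_simps)
        finally show ?thesis unfolding b(2) by simp
      qed
      ultimately have 1: "real n powr (\<gamma> - p) \<le> ((2 * real R) ^ CARD('d)) powr (1 - p)" by simp
      have "real n powr \<gamma> = real n powr p * real n powr (\<gamma> - p)" by (simp flip: powr_add)
      also have "\<dots> < (real n + 1) powr p * real n powr (\<gamma> - p)"
        using n p by (intro mult_strict_right_mono powr_less_mono2) auto
      also have "\<dots> \<le> (real n + 1) powr p * ((2 * real R) ^ CARD('d)) powr (1 - p)"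
        using 1 by (intro mult_left_mono) auto
      finally show "real n powr \<gamma> < (real n + 1) powr p * ((2 * real R) ^ CARD('d)) powr (1 - p)" .
    qed
    finally show ?case .
  qed
  moreover have "4 * pi\<^sup>2 > 0" by simp
  ultimately show ?thesis by blast
qed

theorem proposition1p6:
  fixes d p \<gamma> :: real
  assumes "CARD('d::finite) \<ge> 5" and "d = real CARD('d)"
  shows
    "(p > d / (d - 2) \<and> p > \<gamma> \<and> \<gamma> > 1 + max (p - 2) 0 / ((d - 2) * p + 4) \<longrightarrow>
       (\<exists>c\<^sub>1>0. \<exists>c\<^sub>2>0. \<forall>\<^sub>F n in sequentially.
          exp (- c\<^sub>1 * real n powr (\<gamma> / p)) \<le>
            \<P>(\<omega> in srw_steps. (\<Sum>\<^sub>\<infinity>x::int^'d. real (local_time (walk \<omega>) n x) powr p) > real n powr \<gamma>) \<and>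
          \<P>(\<omega> in srw_steps. (\<Sum>\<^sub>\<infinity>x::int^'d. real (local_time (walk \<omega>) n x) powr p) > real n powr \<gamma>)
            \<le> exp (- c\<^sub>2 * real n powr (\<gamma> / p)))) \<and>
     (1 < p \<and> p \<le> d / (d - 2) \<and> p > \<gamma> \<and> \<gamma> > 1 \<longrightarrow>
       (let \<zeta> = 1 - 2 / d * ((p - \<gamma>) / (p - 1)) in
        \<forall>\<epsilon>>0. \<exists>d\<^sub>1>0. \<exists>d\<^sub>2>0. \<forall>\<^sub>F n in sequentially.
          exp (- d\<^sub>1 * real n powr \<zeta>) \<le>
            \<P>(\<omega> in srw_steps. (\<Sum>\<^sub>\<infinity>x::int^'d. real (local_time (walk \<omega>) n x) powr p) > real n powr \<gamma>) \<and>
          \<P>(\<omega> in srw_steps. (\<Sum>\<^sub>\<infinity>x::int^'d. real (local_time (walk \<omega>) n x) powr p) > real n powr \<gamma>)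
            \<le> exp (- d\<^sub>2 * real n powr (\<zeta> - \<epsilon>))))"
proof (intro conjI impI)
  assume *: "p > d / (d - 2) \<and> p > \<gamma> \<and> \<gamma> > 1 + max (p - 2) 0 / ((d - 2) * p + 4)"
  have d5: "d \<ge> 5" using assms by simp
  then have "d / (d - 2) > 1" by simp
  with * have p: "p > 1" by linarith
  have "max (p - 2) 0 / ((d - 2) * p + 4) \<ge> 0"
    using p d5 by (intro divide_nonneg_nonneg add_nonneg_nonneg mult_nonneg_nonneg) auto
  with * have \<gamma>: "1 < \<gamma>" "\<gamma> < p" by linarith+
  obtain c\<^sub>1 where c1: "c\<^sub>1 > 0"
    "\<forall>\<^sub>F n in sequentially. exp (- c\<^sub>1 * real n powr (\<gamma> / p)) \<le> tail_prob TYPE('d) p \<gamma> n"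
    using tail_lower_two_points[OF p \<gamma>, where 'd = 'd] by blast
  obtain c\<^sub>2 where c2: "c\<^sub>2 > 0"
    "\<forall>\<^sub>F n in sequentially. tail_prob TYPE('d) p \<gamma> n \<le> exp (- c\<^sub>2 * real n powr (\<gamma> / p))"
    using tail_upper_supercritical[OF assms _ \<gamma>(1), of p] * by blast
  show "\<exists>c\<^sub>1>0. \<exists>c\<^sub>2>0. \<forall>\<^sub>F n in sequentially.
      exp (- c\<^sub>1 * real n powr (\<gamma> / p)) \<le> tail_prob TYPE('d) p \<gamma> n \<and>
      tail_prob TYPE('d) p \<gamma> n \<le> exp (- c\<^sub>2 * real n powr (\<gamma> / p))"
    using c1(1) c2(1) eventually_conj[OF c1(2) c2(2)] by blast
next
  assume *: "1 < p \<and> p \<le> d / (d - 2) \<and> p > \<gamma> \<and> \<gamma> > 1"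
  then have p: "1 < p" "p \<le> d / (d - 2)" and \<gamma>: "1 < \<gamma>" "\<gamma> < p" by auto
  define \<zeta> where "\<zeta> = 1 - 2 / d * ((p - \<gamma>) / (p - 1))"
  have "\<exists>d\<^sub>1>0. \<exists>d\<^sub>2>0. \<forall>\<^sub>F n in sequentially.
      exp (- d\<^sub>1 * real n powr \<zeta>) \<le> tail_prob TYPE('d) p \<gamma> n \<and>
      tail_prob TYPE('d) p \<gamma> n \<le> exp (- d\<^sub>2 * real n powr (\<zeta> - \<epsilon>))" if \<epsilon>: "\<epsilon> > 0" for \<epsilon>
  proof -
    obtain d\<^sub>1 where d1: "d\<^sub>1 > 0"
      "\<forall>\<^sub>F n in sequentially. exp (- d\<^sub>1 * real n powr \<zeta>) \<le> tail_prob TYPE('d) p \<gamma> n"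
      using tail_lower_cube[OF assms(2) p(1) \<gamma> \<zeta>_def] by blast
    obtain d\<^sub>2 where d2: "d\<^sub>2 > 0"
      "\<forall>\<^sub>F n in sequentially. tail_prob TYPE('d) p \<gamma> n \<le> exp (- d\<^sub>2 * real n powr (\<zeta> - \<epsilon>))"
      using tail_upper_subcritical[OF assms p \<gamma> \<zeta>_def \<epsilon>] by blast
    show ?thesis
      using d1(1) d2(1) eventually_conj[OF d1(2) d2(2)] by blast
  qed
  then show "let \<zeta> = 1 - 2 / d * ((p - \<gamma>) / (p - 1)) in
        \<forall>\<epsilon>>0. \<exists>d\<^sub>1>0. \<exists>d\<^sub>2>0. \<forall>\<^sub>F n in sequentially.
          exp (- d\<^sub>1 * real n powr \<zeta>) \<le> tail_prob TYPE('d) p \<gamma> n \<and>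
          tail_prob TYPE('d) p \<gamma> n \<le> exp (- d\<^sub>2 * real n powr (\<zeta> - \<epsilon>))"
    unfolding Let_def \<zeta>_def by blast
qed

end
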